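(* Let $(H,\zeta)$ be a cotriangular Hopf algebra over a field $\Bbbk$. Regard the category ${}^H\mathcal{M}^H$ of $H$-bicomodules as a subcategory of $\mathcal{LR}(H)$ by equipping each $H$-bicomodule $M$ with the actions $h\triangleright m=\zeta(h,m_{[-1]})m_{[0]}$ and $m\triangleleft h=m_{(0)}\zeta(h,m_{(1)})$. Then this Yetter-Drinfel'd-Long subcategory ${}^H\mathcal{M}^H$ is symmetric, i.e. $\psi_{N,M}\circ\psi_{M,N}=\mathrm{id}_{M\otimes N}$ for all $H$-bicomodules $M,N$ equipped with these actions, where $\psi$ is the braiding of $\mathcal{LR}(H)$.
   Context: Everything is over a field $\Bbbk$; Sweedler notation $\Delta(h)=h_1\otimes h_2$ is used with summation omitted. A coquasitriangular Hopf algebra is a pair $(H,\zeta)$ with $H$ a Hopf algebra and $\zeta:H\otimes H\to\Bbbk$ a bilinear form (braiding), convolution invertible in $\mathrm{Hom}_{\Bbbk}(H\otimes H,\Bbbk)$, such that for all $h,g,l\in H$: $\zeta(h,gl)=\zeta(h_1,g)\zeta(h_2,l)$; $\zeta(hg,l)=\zeta(h,l_2)\zeta(g,l_1)$; $\zeta(h_1,g_1)g_2h_2=h_1g_1\zeta(h_2,g_2)$; $\zeta(h,1)=\varepsilon(h)=\zeta(1,h)$. It is cotriangular if moreover $\zeta(h_1,g_1)\zeta(g_2,h_2)=\varepsilon(g)\varepsilon(h)$ for all $g,h\in H$. A Yetter-Drinfel'd-Long bimodule over $H$ is a vector space $M$ which is an $H$-bimodule (left action $h\otimes m\mapsto h\triangleright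 m$, right action $m\otimes h\mapsto m\triangleleft h$, with $(a\triangleright m)\triangleleft b=a\triangleright(m\triangleleft b)$) and an $H$-bicomodule (left coaction $m\mapsto m_{[-1]}\otimes m_{[0]}\in H\otimes M$, right coaction $m\mapsto m_{(0)}\otimes m_{(1)}\in M\otimes H$, with $m_{[-1]}\otimes m_{[0](0)}\otimes m_{[0](1)}=m_{(0)[-1]}\otimes m_{(0)[0]}\otimes m_{(1)}$), such that for all $h\in H$, $m\in M$: $(h_1\triangleright m)_{[-1]}h_2\otimes(h_1\triangleright m)_{[0]}=h_1m_{[-1]}\otimes h_2\triangleright m_{[0]}$; $(h\triangleright m)_{(0)}\otimes(h\triangleright m)_{(1)}=h\triangleright m_{(0)}\otimes m_{(1)}$; $(m\triangleleft h_2)_{(0)}\otimes h_1(m\triangleleft h_2)_{(1)}=m_{(0)}\triangleleft h_1\otimes m_{(1)}h_2$; $(m\triangleleft h)_{[-1]}\otimes(m\triangleleft h)_{[0]}=m_{[-1]}\otimes m_{[0]}\triangleleft h$. $\mathcal{LR}(H)$ is the category of Yetter-Drinfel'd-Long bimodules over $H$, with morphisms the $H$-bilinear and $H$-bicolinear maps. If the antipode of $H$ is bijective it is a braided monoidal category with $h\triangleright(m\otimes n)=h_1\triangleright m\otimes h_2\triangleright n$, $(m\otimes n)\triangleleft h=m\triangleleft h_1\otimes n\triangleleft h_2$, $(m\otimes n)_{[-1]}\otimes(m\otimes n)_{[0]}=m_{[-1]}n_{[-1]}\otimes m_{[0]}\otimes n_{[0]}$, $(m\otimes n)_{(0)}\otimes(m\otimes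 n)_{(1)}=m_{(0)}\otimes n_{(0)}\otimes m_{(1)}n_{(1)}$, and braiding $\psi_{M,N}:M\otimes N\to N\otimes M$, $\psi_{M,N}(m\otimes n)=m_{[-1]}\triangleright n_{(0)}\otimes m_{[0]}\triangleleft n_{(1)}$. *)

theory Defs
  imports Complex_Main "HOL-Library.Function_Algebras"
begin

section \<open>Tensor products over a field\<close>

text \<open>
  For vector spaces V and W over a field k, the tensor product is realised inside the dual of the
  space of bilinear forms on V and W: the pure tensor of v and w is evaluation at (v, w), and the
  tensor product is the span of the pure tensors. Its universal property is proved below.
  HOL functions being total, a tensor takes the value 0 on functions that are not bilinear.
\<close>

type_synonym ('k, 'v, 'w) tensor = "('v \<Rightarrow> 'w \<Rightarrow> 'k) \<Rightarrow> 'k"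
type_synonym ('k, 'u, 'v, 'w) tensor3 = "('u \<Rightarrow> 'v \<Rightarrow> 'w \<Rightarrow> 'k) \<Rightarrow> 'k"

definition bilinear_map ::
  "('k::field \<Rightarrow> 'v::ab_group_add \<Rightarrow> 'v) \<Rightarrow> ('k \<Rightarrow> 'w::ab_group_add \<Rightarrow> 'w) \<Rightarrow> ('k \<Rightarrow> 'p::ab_group_add \<Rightarrow> 'p)
    \<Rightarrow> ('v \<Rightarrow> 'w \<Rightarrow> 'p) \<Rightarrow> bool" where
  "bilinear_map sV sW sP f \<longleftrightarrow>
     (\<forall>v. Vector_Spaces.linear sW sP (\<lambda>w. f v w)) \<and>
     (\<forall>w. Vector_Spaces.linear sV sP (\<lambda>v. f v w))"

definition trilinear_form ::
  "('k::field \<Rightarrow> 'u::ab_group_add \<Rightarrow> 'u) \<Rightarrow> ('k \<Rightarrow> 'v::ab_group_add \<Rightarrow> 'v) \<Rightarrow> ('k \<Rightarrow> 'w::ab_group_add \<Rightarrow> 'w)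
    \<Rightarrow> ('u \<Rightarrow> 'v \<Rightarrow> 'w \<Rightarrow> 'k) \<Rightarrow> bool" where
  "trilinear_form sU sV sW f \<longleftrightarrow>
     (\<forall>u v. Vector_Spaces.linear sW (*) (\<lambda>w. f u v w)) \<and>
     (\<forall>u w. Vector_Spaces.linear sV (*) (\<lambda>v. f u v w)) \<and>
     (\<forall>v w. Vector_Spaces.linear sU (*) (\<lambda>u. f u v w))"

definition tens ::
  "('k::field \<Rightarrow> 'v::ab_group_add \<Rightarrow> 'v) \<Rightarrow> ('k \<Rightarrow> 'w::ab_group_add \<Rightarrow> 'w) \<Rightarrow> 'v \<Rightarrow> 'w \<Rightarrow> ('k, 'v, 'w) tensor" where
  "tens sV sW v w = (\<lambda>B. if bilinear_map sV sW (*) B then B v w else 0)"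

definition tens3 ::
  "('k::field \<Rightarrow> 'u::ab_group_add \<Rightarrow> 'u) \<Rightarrow> ('k \<Rightarrow> 'v::ab_group_add \<Rightarrow> 'v) \<Rightarrow> ('k \<Rightarrow> 'w::ab_group_add \<Rightarrow> 'w)
    \<Rightarrow> 'u \<Rightarrow> 'v \<Rightarrow> 'w \<Rightarrow> ('k, 'u, 'v, 'w) tensor3" where
  "tens3 sU sV sW u v w = (\<lambda>T. if trilinear_form sU sV sW T then T u v w else 0)"

definition tscale :: "'k::field \<Rightarrow> ('a \<Rightarrow> 'k) \<Rightarrow> ('a \<Rightarrow> 'k)" where
  "tscale c t = (\<lambda>B. c * t B)"

definition tensor_space ::
  "('k::field \<Rightarrow> 'v::ab_group_add \<Rightarrow> 'v) \<Rightarrow> ('k \<Rightarrow> 'w::ab_group_add \<Rightarrow> 'w) \<Rightarrow> ('k, 'v, 'w) tensor set" where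
  "tensor_space sV sW = module.span tscale {tens sV sW v w | v w. True}"

text \<open>
  The linear map on the tensor product induced by a bilinear map f: write the tensor as a finite sum
  of pure tensors and sum the values of f. Independence of the choice is part of the universal
  property below.
\<close>

definition tensor_lift ::
  "('k::field \<Rightarrow> 'v::ab_group_add \<Rightarrow> 'v) \<Rightarrow> ('k \<Rightarrow> 'w::ab_group_add \<Rightarrow> 'w) \<Rightarrow> ('v \<Rightarrow> 'w \<Rightarrow> 'p::ab_group_add)
    \<Rightarrow> ('k, 'v, 'w) tensor \<Rightarrow> 'p" where
  "tensor_lift sV sW f t =
     (THE p. \<exists>xs. t = (\<Sum>(v, w)\<leftarrow>xs. tens sV sW v w) \<and> p = (\<Sum>(v, w)\<leftarrow>xs. f v w))"

lemma vector_space_tscale: "vector_space (tscale :: 'k::field \<Rightarrow> ('a \<Rightarrow> 'k) \<Rightarrow> _)"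
  by unfold_locales (auto simp: tscale_def algebra_simps)

lemma vector_space_field: "vector_space ((*) :: 'k::field \<Rightarrow> 'k \<Rightarrow> 'k)"
  by unfold_locales (auto simp: algebra_simps)

lemma bilinear_map_tens:
  fixes sV :: "'k::field \<Rightarrow> 'v::ab_group_add \<Rightarrow> 'v" and sW :: "'k \<Rightarrow> 'w::ab_group_add \<Rightarrow> 'w"
  assumes "vector_space sV" "vector_space sW"
  shows "bilinear_map sV sW tscale (tens sV sW)"
proof -
  have lin: "Vector_Spaces.linear s tscale g"
    if "vector_space s" "\<And>B. Vector_Spaces.linear s (*) (\<lambda>x. g x B)"
    for s :: "'k \<Rightarrow> 'z::ab_group_add \<Rightarrow> 'z" and g :: "'z \<Rightarrow> ('k, 'v, 'w) tensor"
    using that vector_space_tscale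
    by (auto simp: Vector_Spaces.linear_iff tscale_def fun_eq_iff)
  have zero: "Vector_Spaces.linear s (*) (\<lambda>x. 0 :: 'k)"
    if "vector_space s" for s :: "'k \<Rightarrow> 'z::ab_group_add \<Rightarrow> 'z"
    using that vector_space_field by (auto simp: Vector_Spaces.linear_iff)
  show ?thesis
    unfolding bilinear_map_def
  proof (intro conjI allI)
    fix v show "Vector_Spaces.linear sW tscale (\<lambda>w. tens sV sW v w)"
    proof (rule lin[OF assms(2)])
      fix B show "Vector_Spaces.linear sW (*) (\<lambda>w. tens sV sW v w B)"
        by (cases "bilinear_map sV sW (*) B")
          (simp_all add: tens_def zero[OF assms(2)], simp add: bilinear_map_def)
    qed
  next
    fix w show "Vector_Spaces.linear sV tscale (\<lambda>v. tens sV sW v w)"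
    proof (rule lin[OF assms(1)])
      fix B show "Vector_Spaces.linear sV (*) (\<lambda>v. tens sV sW v w B)"
        by (cases "bilinear_map sV sW (*) B")
          (simp_all add: tens_def zero[OF assms(1)], simp add: bilinear_map_def)
    qed
  qed
qed

lemma tensor_space_eq_sums:
  fixes sV :: "'k::field \<Rightarrow> 'v::ab_group_add \<Rightarrow> 'v" and sW :: "'k \<Rightarrow> 'w::ab_group_add \<Rightarrow> 'w"
  assumes "vector_space sV" "vector_space sW"
  shows "tensor_space sV sW = range (\<lambda>xs. \<Sum>(v, w)\<leftarrow>xs. tens sV sW v w)" (is "_ = range ?S")
proof
  interpret T: vector_space "tscale :: 'k \<Rightarrow> ('k, 'v, 'w) tensor \<Rightarrow> _"
    by (rule vector_space_tscale)
  have sc: "tscale c (tens sV sW v w) = tens sV sW (sV c v) w" for c v w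
    using bilinear_map_tens[OF assms] by (simp add: bilinear_map_def Vector_Spaces.linear_iff)
  have sc': "tens sV sW (sV c v) w B = c * tens sV sW v w B" for c v w B
    using fun_cong[OF sc[of c v w], of B] by (simp add: tscale_def)
  have "T.subspace (range ?S)"
  proof (rule T.subspaceI)
    show "0 \<in> range ?S" by (rule range_eqI[of _ _ "[]"]) simp
    show "x + y \<in> range ?S" if "x \<in> range ?S" "y \<in> range ?S" for x y
    proof -
      from that obtain xs ys where "x = ?S xs" "y = ?S ys" by blast
      then have "x + y = ?S (xs @ ys)" by simp
      then show ?thesis by (rule range_eqI)
    qed
    show "tscale c x \<in> range ?S" if "x \<in> range ?S" for c x
    proof -
      from that obtain xs where x: "x = ?S xs" by blast
      have "tscale c (?S xs) = ?S (map (\<lambda>(v, w). (sV c v, w)) xs)"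
        by (induction xs) (auto simp: fun_eq_iff tscale_def distrib_left sc')
      then show ?thesis unfolding x by (rule range_eqI)
    qed
  qed
  moreover have "{tens sV sW v w | v w. True} \<subseteq> range ?S"
  proof clarify
    fix v w
    show "tens sV sW v w \<in> range ?S" by (rule range_eqI[of _ _ "[(v, w)]"]) simp
  qed
  ultimately show "tensor_space sV sW \<subseteq> range ?S"
    unfolding tensor_space_def by (rule T.span_minimal[rotated])
next
  interpret T: vector_space "tscale :: 'k \<Rightarrow> ('k, 'v, 'w) tensor \<Rightarrow> _"
    by (rule vector_space_tscale)
  have "?S xs \<in> tensor_space sV sW" for xs
    unfolding tensor_space_def
  proof (induction xs)
    case Nil
    then show ?case by (simp only: list.map sum_list.Nil T.span_zero)
  next
    case (Cons x xs)
    have "(case x of (v, w) \<Rightarrow> tens sV sW v w) \<in> T.span {tens sV sW v w | v w. True}"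
      by (auto simp: split_beta intro: T.span_base)
    with Cons show ?case by (simp only: list.map sum_list.Cons T.span_add)
  qed
  then show "range ?S \<subseteq> tensor_space sV sW" by blast
qed

lemma separating_functional:
  fixes sP :: "'k::field \<Rightarrow> 'p::ab_group_add \<Rightarrow> 'p"
  assumes "vector_space sP" "p \<noteq> 0"
  shows "\<exists>\<phi>. Vector_Spaces.linear sP (*) \<phi> \<and> \<phi> p \<noteq> 0"
proof -
  interpret P: vector_space_pair sP "(*) :: 'k \<Rightarrow> _"
    using assms(1) vector_space_field by (simp add: vector_space_pair_def)
  have "\<not> P.vs1.dependent {p}" using assms(2) by simp
  from P.linear_independent_extend[OF this, of "\<lambda>_. 1"]
  show ?thesis by force
qed

lemma tensor_lift_sum:
  fixes sV :: "'k::field \<Rightarrow> 'v::ab_group_add \<Rightarrow> 'v" and sW :: "'k \<Rightarrow> 'w::ab_group_add \<Rightarrow> 'w" and sP :: "'k \<Rightarrow> 'p::ab_group_add \<Rightarrow> 'p"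
  assumes "vector_space sV" "vector_space sW" "vector_space sP" "bilinear_map sV sW sP f"
  shows "tensor_lift sV sW f (\<Sum>(v, w)\<leftarrow>xs. tens sV sW v w) = (\<Sum>(v, w)\<leftarrow>xs. f v w)"
proof -
  have wd: "(\<Sum>(v, w)\<leftarrow>xs. f v w) = (\<Sum>(v, w)\<leftarrow>ys. f v w)"
    if eq: "(\<Sum>(v, w)\<leftarrow>xs. tens sV sW v w) = (\<Sum>(v, w)\<leftarrow>ys. tens sV sW v w)" for xs ys
  proof (rule ccontr)
    let ?F = "\<lambda>xs. \<Sum>(v, w)\<leftarrow>xs. f v w"
    assume "?F xs \<noteq> ?F ys"
    then have "?F xs - ?F ys \<noteq> 0" by simp
    from separating_functional[OF assms(3) this] obtain \<phi>
      where \<phi>: "Vector_Spaces.linear sP (*) \<phi>" "\<phi> (?F xs - ?F ys) \<noteq> 0" by blast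
    interpret L: Vector_Spaces.linear sP "(*)" \<phi> by (fact \<phi>(1))
    let ?B = "\<lambda>v w. \<phi> (f v w)"
    have B: "bilinear_map sV sW (*) ?B"
      using assms \<phi>(1) by (auto simp: bilinear_map_def Vector_Spaces.linear_iff)
    have ev: "(\<Sum>(v, w)\<leftarrow>zs. tens sV sW v w) ?B = \<phi> (?F zs)" for zs
      using B by (induction zs) (auto simp: tens_def L.add L.zero)
    show False using \<phi>(2) ev[of xs] ev[of ys] eq by (simp add: L.diff)
  qed
  show ?thesis
    unfolding tensor_lift_def
  proof (rule the_equality)
    show "\<exists>ys. (\<Sum>(v, w)\<leftarrow>xs. tens sV sW v w) = (\<Sum>(v, w)\<leftarrow>ys. tens sV sW v w) \<and>
        (\<Sum>(v, w)\<leftarrow>xs. f v w) = (\<Sum>(v, w)\<leftarrow>ys. f v w)"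
      by (intro exI[of _ xs] conjI refl)
  qed (elim exE conjE, drule wd, simp only:)
qed

theorem tensor_lift_universal:
  fixes sV :: "'k::field \<Rightarrow> 'v::ab_group_add \<Rightarrow> 'v" and sW :: "'k \<Rightarrow> 'w::ab_group_add \<Rightarrow> 'w" and sP :: "'k \<Rightarrow> 'p::ab_group_add \<Rightarrow> 'p"
  assumes "vector_space sV" "vector_space sW" "vector_space sP" "bilinear_map sV sW sP f"
  shows "tensor_lift sV sW f (tens sV sW v w) = f v w"
    and "\<lbrakk>s \<in> tensor_space sV sW; t \<in> tensor_space sV sW\<rbrakk>
         \<Longrightarrow> tensor_lift sV sW f (s + t) = tensor_lift sV sW f s + tensor_lift sV sW f t"
    and "t \<in> tensor_space sV sW \<Longrightarrow> tensor_lift sV sW f (tscale c t) = sP c (tensor_lift sV sW f t)"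
proof -
  note sum = tensor_lift_sum[OF assms] and sp = tensor_space_eq_sums[OF assms(1,2)]
  interpret P: vector_space sP by (fact assms(3))
  show "tensor_lift sV sW f (tens sV sW v w) = f v w"
    using sum[of "[(v, w)]"] by simp
  show "tensor_lift sV sW f (s + t) = tensor_lift sV sW f s + tensor_lift sV sW f t"
    if "s \<in> tensor_space sV sW" "t \<in> tensor_space sV sW"
  proof -
    from that obtain xs ys where st: "s = (\<Sum>(v, w)\<leftarrow>xs. tens sV sW v w)" "t = (\<Sum>(v, w)\<leftarrow>ys. tens sV sW v w)"
      unfolding sp by blast
    then show ?thesis using sum[of "xs @ ys"] sum[of xs] sum[of ys] by simp
  qed
  show "tensor_lift sV sW f (tscale c t) = sP c (tensor_lift sV sW f t)" if t: "t \<in> tensor_space sV sW"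
  proof -
    interpret T: vector_space "tscale :: 'k \<Rightarrow> ('k, 'v, 'w) tensor \<Rightarrow> _"
      by (rule vector_space_tscale)
    from t obtain xs where t: "t = (\<Sum>(v, w)\<leftarrow>xs. tens sV sW v w)" unfolding sp by blast
    let ?m = "map (\<lambda>(v, w). (sV c v, w)) xs"
    have "tscale c t = (\<Sum>(v, w)\<leftarrow>?m. tens sV sW v w)"
      unfolding t using bilinear_map_tens[OF assms(1,2)]
      by (induction xs) (auto simp: T.scale_right_distrib bilinear_map_def Vector_Spaces.linear_iff)
    moreover have "(\<Sum>(v, w)\<leftarrow>?m. f v w) = sP c (\<Sum>(v, w)\<leftarrow>xs. f v w)"
      using assms(4)
      by (induction xs) (auto simp: P.scale_right_distrib bilinear_map_def Vector_Spaces.linear_iff)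
    ultimately show ?thesis using sum[of ?m] sum[of xs] t by simp
  qed
qed


section \<open>Cotriangular Hopf algebras\<close>

text \<open>
  Ring structures come from the type class; the scalar action and the coalgebra structure are
  carried by the record.
\<close>

record ('k, 'h) hopf_data =
  hscale :: "'k \<Rightarrow> 'h \<Rightarrow> 'h"
  comult :: "'h \<Rightarrow> ('k, 'h, 'h) tensor"
  counit :: "'h \<Rightarrow> 'k"
  antipode :: "'h \<Rightarrow> 'h"

text \<open>
  Sweedler notation: \<open>sw H h (\<lambda>h1 h2. E h1 h2)\<close> is the sum of the E(h1, h2) with h1, h2 the
  components of the coproduct of h.
\<close>

abbreviation sw ::
  "('k::field, 'h::ring_1) hopf_data \<Rightarrow> 'h \<Rightarrow> ('h \<Rightarrow> 'h \<Rightarrow> 'p::ab_group_add) \<Rightarrow> 'p" where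
  "sw H h E \<equiv> tensor_lift (hscale H) (hscale H) E (comult H h)"

locale hopf_algebra =
  fixes H :: "('k::field, 'h::ring_1) hopf_data"
  assumes vector_space_H: "vector_space (hscale H)"
    and scale_mult_left: "hscale H c (x * y) = hscale H c x * y"
    and scale_mult_right: "hscale H c (x * y) = x * hscale H c y"
    and comult_linear: "Vector_Spaces.linear (hscale H) tscale (comult H)"
    and comult_space: "comult H h \<in> tensor_space (hscale H) (hscale H)"
    and counit_linear: "Vector_Spaces.linear (hscale H) (*) (counit H)"
    and coassoc:
      "sw H h (\<lambda>h1 h2. sw H h1 (\<lambda>h11 h12. tens3 (hscale H) (hscale H) (hscale H) h11 h12 h2)) =
       sw H h (\<lambda>h1 h2. sw H h2 (\<lambda>h21 h22. tens3 (hscale H) (hscale H) (hscale H) h1 h21 h22))"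
    and counit_left: "sw H h (\<lambda>h1 h2. hscale H (counit H h1) h2) = h"
    and counit_right: "sw H h (\<lambda>h1 h2. hscale H (counit H h2) h1) = h"
    and comult_mult:
      "comult H (h * g) = sw H h (\<lambda>h1 h2. sw H g (\<lambda>g1 g2. tens (hscale H) (hscale H) (h1 * g1) (h2 * g2)))"
    and comult_one: "comult H 1 = tens (hscale H) (hscale H) 1 1"
    and counit_mult: "counit H (h * g) = counit H h * counit H g"
    and counit_one: "counit H 1 = 1"
    and antipode_linear: "Vector_Spaces.linear (hscale H) (hscale H) (antipode H)"
    and antipode_left: "sw H h (\<lambda>h1 h2. antipode H h1 * h2) = hscale H (counit H h) 1"
    and antipode_right: "sw H h (\<lambda>h1 h2. h1 * antipode H h2) = hscale H (counit H h) 1"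

locale coquasitriangular_hopf_algebra = hopf_algebra H
  for H :: "('k::field, 'h::ring_1) hopf_data" +
  fixes \<zeta> :: "'h \<Rightarrow> 'h \<Rightarrow> 'k"
  assumes braiding_bilinear: "bilinear_map (hscale H) (hscale H) (*) \<zeta>"
    and braiding_invertible:
      "\<exists>\<xi>. bilinear_map (hscale H) (hscale H) (*) \<xi> \<and>
        (\<forall>h g. sw H h (\<lambda>h1 h2. sw H g (\<lambda>g1 g2. \<zeta> h1 g1 * \<xi> h2 g2)) = counit H h * counit H g) \<and>
        (\<forall>h g. sw H h (\<lambda>h1 h2. sw H g (\<lambda>g1 g2. \<xi> h1 g1 * \<zeta> h2 g2)) = counit H h * counit H g)"
    and braiding_mult_right: "\<zeta> h (g * l) = sw H h (\<lambda>h1 h2. \<zeta> h1 g * \<zeta> h2 l)"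
    and braiding_mult_left: "\<zeta> (h * g) l = sw H l (\<lambda>l1 l2. \<zeta> h l2 * \<zeta> g l1)"
    and braiding_commute:
      "sw H h (\<lambda>h1 h2. sw H g (\<lambda>g1 g2. hscale H (\<zeta> h1 g1) (g2 * h2))) =
       sw H h (\<lambda>h1 h2. sw H g (\<lambda>g1 g2. hscale H (\<zeta> h2 g2) (h1 * g1)))"
    and braiding_one_right: "\<zeta> h 1 = counit H h"
    and braiding_one_left: "\<zeta> 1 h = counit H h"

locale cotriangular_hopf_algebra = coquasitriangular_hopf_algebra H \<zeta>
  for H :: "('k::field, 'h::ring_1) hopf_data" and \<zeta> :: "'h \<Rightarrow> 'h \<Rightarrow> 'k" +
  assumes cotriangular:
    "sw H h (\<lambda>h1 h2. sw H g (\<lambda>g1 g2. \<zeta> h1 g1 * \<zeta> g2 h2)) = counit H g * counit H h"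


section \<open>Bicomodules and Yetter-Drinfel'd-Long bimodules\<close>

record ('k, 'h, 'm) bicomodule_data =
  vscale :: "'k \<Rightarrow> 'm \<Rightarrow> 'm"
  lcoact :: "'m \<Rightarrow> ('k, 'h, 'm) tensor"
  rcoact :: "'m \<Rightarrow> ('k, 'm, 'h) tensor"

text \<open>Sweedler sums over the left coaction (\<open>swl\<close>) and the right coaction (\<open>swr\<close>) of an element.\<close>

abbreviation swl ::
  "('k::field, 'h::ring_1) hopf_data \<Rightarrow> ('k, 'h, 'm::ab_group_add, 'z) bicomodule_data_scheme
    \<Rightarrow> 'm \<Rightarrow> ('h \<Rightarrow> 'm \<Rightarrow> 'p::ab_group_add) \<Rightarrow> 'p" where
  "swl H M m E \<equiv> tensor_lift (hscale H) (vscale M) E (lcoact M m)"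

abbreviation swr ::
  "('k::field, 'h::ring_1) hopf_data \<Rightarrow> ('k, 'h, 'm::ab_group_add, 'z) bicomodule_data_scheme
    \<Rightarrow> 'm \<Rightarrow> ('m \<Rightarrow> 'h \<Rightarrow> 'p::ab_group_add) \<Rightarrow> 'p" where
  "swr H M m E \<equiv> tensor_lift (vscale M) (hscale H) E (rcoact M m)"

locale bicomodule =
  fixes H :: "('k::field, 'h::ring_1) hopf_data"
    and M :: "('k, 'h, 'm::ab_group_add, 'z) bicomodule_data_scheme"
  assumes vector_space_M: "vector_space (vscale M)"
    and lcoact_linear: "Vector_Spaces.linear (vscale M) tscale (lcoact M)"
    and lcoact_space: "lcoact M m \<in> tensor_space (hscale H) (vscale M)"
    and rcoact_linear: "Vector_Spaces.linear (vscale M) tscale (rcoact M)"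
    and rcoact_space: "rcoact M m \<in> tensor_space (vscale M) (hscale H)"
    and lcoact_coassoc:
      "swl H M m (\<lambda>a m0. sw H a (\<lambda>a1 a2. tens3 (hscale H) (hscale H) (vscale M) a1 a2 m0)) =
       swl H M m (\<lambda>a m0. swl H M m0 (\<lambda>b m00. tens3 (hscale H) (hscale H) (vscale M) a b m00))"
    and lcoact_counit: "swl H M m (\<lambda>a m0. vscale M (counit H a) m0) = m"
    and rcoact_coassoc:
      "swr H M m (\<lambda>m0 a. sw H a (\<lambda>a1 a2. tens3 (vscale M) (hscale H) (hscale H) m0 a1 a2)) =
       swr H M m (\<lambda>m0 b. swr H M m0 (\<lambda>m00 a. tens3 (vscale M) (hscale H) (hscale H) m00 a b))"
    and rcoact_counit: "swr H M m (\<lambda>m0 a. vscale M (counit H a) m0) = m"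
    and coact_commute:
      "swl H M m (\<lambda>a m0. swr H M m0 (\<lambda>m00 b. tens3 (hscale H) (vscale M) (hscale H) a m00 b)) =
       swr H M m (\<lambda>m0 b. swl H M m0 (\<lambda>a m00. tens3 (hscale H) (vscale M) (hscale H) a m00 b))"

definition bicomodule_hom ::
  "('k::field, 'h::ring_1) hopf_data \<Rightarrow> ('k, 'h, 'm::ab_group_add, 'y) bicomodule_data_scheme
    \<Rightarrow> ('k, 'h, 'n::ab_group_add, 'z) bicomodule_data_scheme \<Rightarrow> ('m \<Rightarrow> 'n) \<Rightarrow> bool" where
  "bicomodule_hom H M N f \<longleftrightarrow>
     Vector_Spaces.linear (vscale M) (vscale N) f \<and>
     (\<forall>m. lcoact N (f m) = swl H M m (\<lambda>a m0. tens (hscale H) (vscale N) a (f m0))) \<and>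
     (\<forall>m. rcoact N (f m) = swr H M m (\<lambda>m0 a. tens (vscale N) (hscale H) (f m0) a))"

record ('k, 'h, 'm) yd_long_data = "('k, 'h, 'm) bicomodule_data" +
  lact :: "'h \<Rightarrow> 'm \<Rightarrow> 'm"
  ract :: "'m \<Rightarrow> 'h \<Rightarrow> 'm"

locale yd_long_bimodule = bicomodule H M
  for H :: "('k::field, 'h::ring_1) hopf_data"
    and M :: "('k, 'h, 'm::ab_group_add) yd_long_data" +
  assumes lact_bilinear: "bilinear_map (hscale H) (vscale M) (vscale M) (lact M)"
    and ract_bilinear: "bilinear_map (vscale M) (hscale H) (vscale M) (ract M)"
    and lact_mult: "lact M (h * g) m = lact M h (lact M g m)"
    and lact_one: "lact M 1 m = m"
    and ract_mult: "ract M m (h * g) = ract M (ract M m h) g"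
    and ract_one: "ract M m 1 = m"
    and act_commute: "ract M (lact M h m) g = lact M h (ract M m g)"
    and lact_lcoact:
      "sw H h (\<lambda>h1 h2. swl H M (lact M h1 m) (\<lambda>a n. tens (hscale H) (vscale M) (a * h2) n)) =
       sw H h (\<lambda>h1 h2. swl H M m (\<lambda>a m0. tens (hscale H) (vscale M) (h1 * a) (lact M h2 m0)))"
    and lact_rcoact:
      "rcoact M (lact M h m) = swr H M m (\<lambda>m0 b. tens (vscale M) (hscale H) (lact M h m0) b)"
    and ract_rcoact:
      "sw H h (\<lambda>h1 h2. swr H M (ract M m h2) (\<lambda>n b. tens (vscale M) (hscale H) n (h1 * b))) =
       sw H h (\<lambda>h1 h2. swr H M m (\<lambda>m0 b. tens (vscale M) (hscale H) (ract M m0 h1) (b * h2)))"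
    and ract_lcoact:
      "lcoact M (ract M m h) = swl H M m (\<lambda>a m0. tens (hscale H) (vscale M) a (ract M m0 h))"

definition yd_long_hom ::
  "('k::field, 'h::ring_1) hopf_data \<Rightarrow> ('k, 'h, 'm::ab_group_add) yd_long_data
    \<Rightarrow> ('k, 'h, 'n::ab_group_add) yd_long_data \<Rightarrow> ('m \<Rightarrow> 'n) \<Rightarrow> bool" where
  "yd_long_hom H M N f \<longleftrightarrow>
     bicomodule_hom H M N f \<and>
     (\<forall>h m. f (lact M h m) = lact N h (f m)) \<and>
     (\<forall>m h. f (ract M m h) = ract N (f m) h)"

definition yd_long_braiding ::
  "('k::field, 'h::ring_1) hopf_data \<Rightarrow> ('k, 'h, 'm::ab_group_add) yd_long_data
    \<Rightarrow> ('k, 'h, 'n::ab_group_add) yd_long_data \<Rightarrow> ('k, 'm, 'n) tensor \<Rightarrow> ('k, 'n, 'm) tensor" where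
  "yd_long_braiding H M N =
     tensor_lift (vscale M) (vscale N)
       (\<lambda>m n. swl H M m (\<lambda>a m0. swr H N n (\<lambda>n0 b.
          tens (vscale N) (vscale M) (lact N a n0) (ract M m0 b))))"

definition with_braiding_actions ::
  "('k::field, 'h::ring_1) hopf_data \<Rightarrow> ('h \<Rightarrow> 'h \<Rightarrow> 'k) \<Rightarrow> ('k, 'h, 'm::ab_group_add) bicomodule_data
    \<Rightarrow> ('k, 'h, 'm) yd_long_data" where
  "with_braiding_actions H \<zeta> M =
     \<lparr>vscale = vscale M, lcoact = lcoact M, rcoact = rcoact M,
      lact = (\<lambda>h m. swl H M m (\<lambda>a m0. vscale M (\<zeta> h a) m0)),
      ract = (\<lambda>m h. swr H M m (\<lambda>m0 b. vscale M (\<zeta> h b) m0))\<rparr>"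

end

theory Submission
  imports Defs
begin

text \<open>
  In Sweedler notation each axiom of a Yetter-Drinfel'd-Long bimodule is an immediate consequence of
  an axiom on the braiding \<open>\<zeta>\<close>: multiplicativity and unitality in the first argument make \<open>\<rhd>\<close> and \<open>\<lhd>\<close> actions,
  the relation \<open>\<zeta>(h\<^sub>1, g\<^sub>1) g\<^sub>2 h\<^sub>2 = h\<^sub>1 g\<^sub>1 \<zeta>(h\<^sub>2, g\<^sub>2)\<close> makes \<open>\<rhd>\<close> compatible with the left coaction and
  \<open>\<lhd>\<close> with the right one, and the mixed conditions hold because the two coactions commute. Bicolinear
  maps commute with the actions, since these are defined from the coactions.

  For the symmetry, let F be a bilinear map on M and N, for example the pure tensor, and put
  \<open>(A F)(m, n) = F(m\<^sub>0, m\<^sub>-\<^sub>1 \<rhd> n)\<close>, \<open>(A' F)(m, n) = F(n\<^sub>-\<^sub>1 \<rhd> m, n\<^sub>0)\<close>,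
  \<open>(B F)(m, n) = F(m \<lhd> n\<^sub>1, n\<^sub>0)\<close> and \<open>(B' F)(m, n) = F(m\<^sub>0, n \<lhd> m\<^sub>1)\<close>.
  Since \<open>\<rhd>\<close> is right colinear, the double braiding of m and n is \<open>A B A' B'\<close> applied to the pure
  tensor. The operators B and A' commute, because the two coactions commute and so do the two actions.
  What remains is \<open>A A' = id\<close> (\<open>left_braiding_cancel\<close>) and \<open>B B' = id\<close> (\<open>right_braiding_cancel\<close>): after expanding
  the actions, coassociativity produces the sum \<open>\<zeta>(h\<^sub>1, g\<^sub>1) \<zeta>(g\<^sub>2, h\<^sub>2)\<close>, which cotriangularity
  replaces by counits.

  Three facts make this calculus rigorous for sums over tensors: a linear map commutes with a Sweedler
  sum (\<open>linear_tensor_lift\<close>), independent Sweedler sums may be exchanged (\<open>tensor_lift_swap\<close>), and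
  coassociativity, stated for pure threefold tensors, holds for all trilinear maps
  (\<open>tens3_identity_transfer\<close>).
\<close>

section \<open>Linear maps out of tensor products\<close>

text \<open>
  The rules \<open>linear_intros\<close> prove that an expression is linear in a variable, allowing the variable in
  one argument of the outermost operation only, together with the side conditions on vector spaces and
  membership in tensor spaces. Once the scalar action on the values is known, at most one argument can
  be chosen, so resolution with these rules proves multilinearity of Sweedler expressions without
  backtracking.
\<close>

named_theorems linear_intros

lemma vector_space_of_linear:
  assumes "Vector_Spaces.linear s1 s2 f"
  shows "vector_space s1" "vector_space s2"
  using assms by (simp_all add: Vector_Spaces.linear_iff)

lemma vector_space_of_bilinear:
  assumes "bilinear_map sV sW sP f"
  shows "vector_space sV" "vector_space sW" "vector_space sP"
  using assms unfolding bilinear_map_def by (auto dest: vector_space_of_linear)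

lemma linear_compose:
  assumes "Vector_Spaces.linear s2 s3 f" "Vector_Spaces.linear s1 s2 g"
  shows "Vector_Spaces.linear s1 s3 (\<lambda>x. f (g x))"
  using assms by (auto simp: Vector_Spaces.linear_iff)

lemma bilinear_compose_left:
  assumes "bilinear_map sV sW sP f" "Vector_Spaces.linear s sV g"
  shows "Vector_Spaces.linear s sP (\<lambda>x. f (g x) w)"
  using assms unfolding bilinear_map_def by (blast intro: linear_compose[where f = "\<lambda>v. f v w"])

lemma bilinear_compose_right:
  assumes "bilinear_map sV sW sP f" "Vector_Spaces.linear s sW g"
  shows "Vector_Spaces.linear s sP (\<lambda>x. f v (g x))"
  using assms unfolding bilinear_map_def by (blast intro: linear_compose[where f = "\<lambda>w. f v w"])

lemma bilinear_mapI [linear_intros]: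
  assumes "\<And>v. Vector_Spaces.linear sW sP (\<lambda>w. f v w)"
    and "\<And>w. Vector_Spaces.linear sV sP (\<lambda>v. f v w)"
  shows "bilinear_map sV sW sP f"
  using assms by (simp add: bilinear_map_def)

lemma linear_identity [linear_intros]:
  assumes "vector_space s"
  shows "Vector_Spaces.linear s s (\<lambda>x. x)"
  using assms by (simp add: Vector_Spaces.linear_iff)

lemma linear_times_left [linear_intros]:
  fixes f :: "'v::ab_group_add \<Rightarrow> 'k::field"
  assumes "Vector_Spaces.linear s (*) f"
  shows "Vector_Spaces.linear s (*) (\<lambda>x. f x * c)"
  using assms by (auto simp: Vector_Spaces.linear_iff algebra_simps)

lemma linear_times_right [linear_intros]:
  fixes f :: "'v::ab_group_add \<Rightarrow> 'k::field"
  assumes "Vector_Spaces.linear s (*) f"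
  shows "Vector_Spaces.linear s (*) (\<lambda>x. c * f x)"
  using assms by (auto simp: Vector_Spaces.linear_iff algebra_simps)

lemma bilinear_scale:
  assumes "vector_space s"
  shows "bilinear_map (*) s s s"
proof -
  interpret vector_space s by fact
  show ?thesis
    by (auto simp: bilinear_map_def Vector_Spaces.linear_iff assms vector_space_field
        algebra_simps)
qed

lemmas [linear_intros] =
  bilinear_compose_left[OF bilinear_scale] bilinear_compose_right[OF bilinear_scale]
  bilinear_compose_left[OF bilinear_map_tens] bilinear_compose_right[OF bilinear_map_tens]
  vector_space_tscale vector_space_field

lemma tens_in_tensor_space [linear_intros]:
  fixes sV :: "'k::field \<Rightarrow> 'v::ab_group_add \<Rightarrow> 'v" and sW :: "'k \<Rightarrow> 'w::ab_group_add \<Rightarrow> 'w"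
  shows "tens sV sW v w \<in> tensor_space sV sW"
proof -
  interpret T: vector_space "tscale :: 'k \<Rightarrow> ('k, 'v, 'w) tensor \<Rightarrow> _"
    by (rule vector_space_tscale)
  show ?thesis
    unfolding tensor_space_def by (rule T.span_base) blast
qed

text \<open>
  In a Sweedler sum the variable of a linear map occurs either in the summand or in the tensor that
  is summed over; the next two lemmas treat these two cases.
\<close>

lemma linear_tensor_lift_summand [linear_intros]:
  assumes "\<And>x. bilinear_map sV sW sP (f x)"
    and "\<And>v w. Vector_Spaces.linear s sP (\<lambda>x. f x v w)"
    and "t \<in> tensor_space sV sW"
  shows "Vector_Spaces.linear s sP (\<lambda>x. tensor_lift sV sW (f x) t)"
proof -
  note vs = vector_space_of_bilinear[OF assms(1)]
  interpret P: vector_space sP by (rule vs(3))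
  obtain xs where t: "t = (\<Sum>(v, w)\<leftarrow>xs. tens sV sW v w)"
    using assms(3) tensor_space_eq_sums[OF vs(1,2)] by auto
  have "Vector_Spaces.linear s sP (\<lambda>x. \<Sum>(v, w)\<leftarrow>xs. f x v w)"
    using assms(2) vs(3)
    by (induction xs) (auto simp: Vector_Spaces.linear_iff P.scale_right_distrib algebra_simps)
  then show ?thesis
    unfolding t by (simp add: tensor_lift_sum[OF vs assms(1)])
qed

lemma linear_tensor_lift_tensor [linear_intros]:
  assumes "bilinear_map sV sW sP f"
    and "Vector_Spaces.linear s tscale g"
    and "\<And>x. g x \<in> tensor_space sV sW"
  shows "Vector_Spaces.linear s sP (\<lambda>x. tensor_lift sV sW f (g x))"
  using assms tensor_lift_universal(2,3)[OF vector_space_of_bilinear[OF assms(1)] assms(1)]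
    vector_space_of_bilinear(3)[OF assms(1)]
  by (auto simp: Vector_Spaces.linear_iff)

lemma tensor_space_subspace:
  fixes sV :: "'k::field \<Rightarrow> 'v::ab_group_add \<Rightarrow> 'v" and sW :: "'k \<Rightarrow> 'w::ab_group_add \<Rightarrow> 'w"
  shows "0 \<in> tensor_space sV sW"
    and "\<lbrakk>s \<in> tensor_space sV sW; t \<in> tensor_space sV sW\<rbrakk> \<Longrightarrow> s + t \<in> tensor_space sV sW"
proof -
  interpret T: vector_space "tscale :: 'k \<Rightarrow> ('k, 'v, 'w) tensor \<Rightarrow> _"
    by (rule vector_space_tscale)
  show "0 \<in> tensor_space sV sW"
    and "\<lbrakk>s \<in> tensor_space sV sW; t \<in> tensor_space sV sW\<rbrakk> \<Longrightarrow> s + t \<in> tensor_space sV sW"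
    unfolding tensor_space_def by (rule T.span_zero, rule T.span_add)
qed

lemma tensor_lift_in_tensor_space:
  assumes "bilinear_map sV sW tscale f" "\<And>v w. f v w \<in> tensor_space sA sB"
    and "t \<in> tensor_space sV sW"
  shows "tensor_lift sV sW f t \<in> tensor_space sA sB"
proof -
  note vs = vector_space_of_bilinear[OF assms(1)]
  obtain xs where t: "t = (\<Sum>(v, w)\<leftarrow>xs. tens sV sW v w)"
    using assms(3) tensor_space_eq_sums[OF vs(1,2)] by auto
  show ?thesis
    unfolding t tensor_lift_sum[OF vs assms(1)] using assms(2)
    by (induction xs) (auto simp: tensor_space_subspace)
qed

text \<open>
  Additivity of \<open>\<phi>\<close> on a set containing the values of f suffices. This matters for maps \<open>\<phi>\<close> that are
  lifts, which are additive only on the tensor space.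
\<close>

lemma linear_on_tensor_lift:
  assumes "bilinear_map sV sW sP f" "bilinear_map sV sW sQ (\<lambda>v w. \<phi> (f v w))"
    and "t \<in> tensor_space sV sW"
    and "0 \<in> S" "\<And>x y. x \<in> S \<Longrightarrow> y \<in> S \<Longrightarrow> x + y \<in> S" "\<And>v w. f v w \<in> S"
    and "\<And>x y. x \<in> S \<Longrightarrow> y \<in> S \<Longrightarrow> \<phi> (x + y) = \<phi> x + \<phi> y"
  shows "\<phi> (tensor_lift sV sW f t) = tensor_lift sV sW (\<lambda>v w. \<phi> (f v w)) t"
proof -
  note vsP = vector_space_of_bilinear[OF assms(1)] and vsQ = vector_space_of_bilinear[OF assms(2)]
  have zero: "\<phi> 0 = 0" using assms(7)[OF assms(4,4)] by simp
  obtain xs where t: "t = (\<Sum>(v, w)\<leftarrow>xs. tens sV sW v w)"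
    using assms(3) tensor_space_eq_sums[OF vsP(1,2)] by auto
  have "(\<Sum>(v, w)\<leftarrow>xs. f v w) \<in> S \<and> \<phi> (\<Sum>(v, w)\<leftarrow>xs. f v w) = (\<Sum>(v, w)\<leftarrow>xs. \<phi> (f v w))"
    using assms(4-7) zero by (induction xs) auto
  then show ?thesis
    unfolding t by (simp add: tensor_lift_sum[OF vsP assms(1)] tensor_lift_sum[OF vsQ assms(2)])
qed

lemma linear_tensor_lift:
  assumes "Vector_Spaces.linear sP sQ \<phi>" "bilinear_map sV sW sP f" "t \<in> tensor_space sV sW"
  shows "\<phi> (tensor_lift sV sW f t) = tensor_lift sV sW (\<lambda>v w. \<phi> (f v w)) t"
proof (rule linear_on_tensor_lift[where S = UNIV, OF assms(2) _ assms(3)])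
  show "bilinear_map sV sW sQ (\<lambda>v w. \<phi> (f v w))"
    using assms(1,2) by (auto simp: bilinear_map_def intro: linear_compose[OF assms(1)])
qed (use assms(1) in \<open>auto simp: Vector_Spaces.linear_iff\<close>)

lemma tensor_lift_tens:
  assumes "vector_space sV" "vector_space sW" "t \<in> tensor_space sV sW"
  shows "tensor_lift sV sW (tens sV sW) t = t"
  using assms(3) tensor_lift_sum[OF assms(1,2) vector_space_tscale bilinear_map_tens[OF assms(1,2)]]
  by (auto simp: tensor_space_eq_sums[OF assms(1,2)])

lemma tensor_lift_pure:
  assumes "bilinear_map sV sW sP f"
  shows "tensor_lift sV sW f (tens sV sW v w) = f v w"
  by (rule tensor_lift_universal(1)[OF vector_space_of_bilinear[OF assms] assms])

text \<open>
  The version of \<open>linear_tensor_lift\<close> for a map that is itself a lift, hence linear on the tensor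
  space only.
\<close>

lemma tensor_lift_nested:
  assumes "bilinear_map sA sB sP g" "bilinear_map sV sW tscale f"
    and "\<And>v w. f v w \<in> tensor_space sA sB" "t \<in> tensor_space sV sW"
  shows "tensor_lift sA sB g (tensor_lift sV sW f t) =
    tensor_lift sV sW (\<lambda>v w. tensor_lift sA sB g (f v w)) t"
proof (rule linear_on_tensor_lift[where S = "tensor_space sA sB", OF assms(2) _ assms(4)])
  show "bilinear_map sV sW sP (\<lambda>v w. tensor_lift sA sB g (f v w))"
    using assms(2) by (intro linear_intros assms) (simp_all add: bilinear_map_def)
qed (assumption | rule tensor_space_subspace assms(3)
    tensor_lift_universal(2)[OF vector_space_of_bilinear[OF assms(1)] assms(1)])+

lemma tensor_lift_swap:
  assumes "\<And>v w. bilinear_map sA sB sP (f v w)"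
    and "\<And>a b. bilinear_map sV sW sP (\<lambda>v w. f v w a b)"
    and "s \<in> tensor_space sA sB" "t \<in> tensor_space sV sW"
  shows "tensor_lift sV sW (\<lambda>v w. tensor_lift sA sB (f v w) s) t =
    tensor_lift sA sB (\<lambda>a b. tensor_lift sV sW (\<lambda>v w. f v w a b) t) s"
proof -
  note vsA = vector_space_of_bilinear[OF assms(1)] and vsV = vector_space_of_bilinear[OF assms(2)]
  have lin: "Vector_Spaces.linear sV sP (\<lambda>v. f v w a b)"
    "Vector_Spaces.linear sW sP (\<lambda>w. f v w a b)"
    "Vector_Spaces.linear sA sP (\<lambda>a. f v w a b)"
    "Vector_Spaces.linear sB sP (\<lambda>b. f v w a b)" for v w a b
    using assms(1,2) by (auto simp: bilinear_map_def)
  obtain xs where t: "t = (\<Sum>(v, w)\<leftarrow>xs. tens sV sW v w)"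
    using assms(4) tensor_space_eq_sums[OF vsV(1,2)] by auto
  obtain ys where s: "s = (\<Sum>(a, b)\<leftarrow>ys. tens sA sB a b)"
    using assms(3) tensor_space_eq_sums[OF vsA(1,2)] by auto
  have 1: "bilinear_map sV sW sP (\<lambda>v w. tensor_lift sA sB (f v w) s)"
    by (intro linear_intros assms lin)
  have 2: "bilinear_map sA sB sP (\<lambda>a b. tensor_lift sV sW (\<lambda>v w. f v w a b) t)"
    by (intro linear_intros assms lin)
  have "tensor_lift sV sW (\<lambda>v w. tensor_lift sA sB (f v w) s) t =
      (\<Sum>(v, w)\<leftarrow>xs. \<Sum>(a, b)\<leftarrow>ys. f v w a b)"
    using tensor_lift_sum[OF vsV 1, of xs] tensor_lift_sum[OF vsA assms(1), of _ _ ys]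
    by (simp add: s t)
  also have "\<dots> = (\<Sum>(a, b)\<leftarrow>ys. \<Sum>(v, w)\<leftarrow>xs. f v w a b)"
  proof (induction xs)
    case (Cons x xs)
    then show ?case by (simp add: split_beta sum_list_addf)
  qed (induction ys, auto)
  also have "\<dots> = tensor_lift sA sB (\<lambda>a b. tensor_lift sV sW (\<lambda>v w. f v w a b) t) s"
    using tensor_lift_sum[OF vsA 2, of ys] tensor_lift_sum[OF vsV assms(2), of _ _ xs]
    by (simp add: s t)
  finally show ?thesis .
qed

lemma eq_if_all_functionals_eq:
  fixes sP :: "'k::field \<Rightarrow> 'p::ab_group_add \<Rightarrow> 'p"
  assumes "vector_space sP" "\<And>\<phi>. Vector_Spaces.linear sP (*) \<phi> \<Longrightarrow> \<phi> x = \<phi> y"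
  shows "x = y"
proof (rule ccontr)
  assume "x \<noteq> y"
  then obtain \<phi> where \<phi>: "Vector_Spaces.linear sP (*) \<phi>" "\<phi> (x - y) \<noteq> 0"
    using separating_functional[OF assms(1), of "x - y"] by auto
  interpret Vector_Spaces.linear sP "(*)" \<phi> by fact
  show False using \<phi>(2) assms(2)[OF \<phi>(1)] by (simp add: diff)
qed

lemma linear_tens3:
  assumes vs: "vector_space sU" "vector_space sV" "vector_space sW"
  shows "Vector_Spaces.linear sU tscale (\<lambda>u. tens3 sU sV sW u v w)"
    and "Vector_Spaces.linear sV tscale (\<lambda>v. tens3 sU sV sW u v w)"
    and "Vector_Spaces.linear sW tscale (\<lambda>w. tens3 sU sV sW u v w)"
  using vs vector_space_tscale
  by (auto simp: Vector_Spaces.linear_iff tens3_def tscale_def fun_eq_iff trilinear_form_def)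

text \<open>
  An identity between iterated Sweedler sums of pure threefold tensors, such as coassociativity,
  holds with the pure tensors replaced by the values of any trilinear map.
\<close>

lemma tens3_identity_transfer:
  fixes sU :: "'k::field \<Rightarrow> 'u::ab_group_add \<Rightarrow> 'u" and sV :: "'k \<Rightarrow> 'v::ab_group_add \<Rightarrow> 'v"
    and sW :: "'k \<Rightarrow> 'w::ab_group_add \<Rightarrow> 'w" and sA :: "'k \<Rightarrow> 'a::ab_group_add \<Rightarrow> 'a"
    and sC :: "'k \<Rightarrow> 'c::ab_group_add \<Rightarrow> 'c" and sP :: "'k \<Rightarrow> 'p::ab_group_add \<Rightarrow> 'p"
  assumes eq: "tensor_lift sA sW (\<lambda>a w. tensor_lift sU sV (\<lambda>u v. tens3 sU sV sW u v w) (g a)) s =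
      tensor_lift sU sC (\<lambda>u c. tensor_lift sV sW (\<lambda>v w. tens3 sU sV sW u v w) (k c)) t"
    and g: "Vector_Spaces.linear sA tscale g" "\<And>a. g a \<in> tensor_space sU sV"
    and k: "Vector_Spaces.linear sC tscale k" "\<And>c. k c \<in> tensor_space sV sW"
    and st: "s \<in> tensor_space sA sW" "t \<in> tensor_space sU sC"
    and F: "\<And>v w. Vector_Spaces.linear sU sP (\<lambda>u. F u v w)"
      "\<And>u w. Vector_Spaces.linear sV sP (\<lambda>v. F u v w)"
      "\<And>u v. Vector_Spaces.linear sW sP (\<lambda>w. F u v w)"
  shows "tensor_lift sA sW (\<lambda>a w. tensor_lift sU sV (\<lambda>u v. F u v w) (g a)) s =
      tensor_lift sU sC (\<lambda>u c. tensor_lift sV sW (\<lambda>v w. F u v w) (k c)) t"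
proof (rule eq_if_all_functionals_eq)
  show "vector_space sP" by (rule vector_space_of_linear(2)[OF F(1)])
  fix \<phi> :: "'p \<Rightarrow> 'k"
  assume \<phi>: "Vector_Spaces.linear sP (*) \<phi>"
  note vs = vector_space_of_linear(1)[OF F(1)] vector_space_of_linear(1)[OF F(2)]
    vector_space_of_linear(1)[OF F(3)]
  let ?T = "\<lambda>u v w. \<phi> (F u v w)"
  note T = linear_compose[OF \<phi> F(1)] linear_compose[OF \<phi> F(2)] linear_compose[OF \<phi> F(3)]
  have tri: "trilinear_form sU sV sW ?T"
    using T by (simp add: trilinear_form_def)
  have ev: "Vector_Spaces.linear tscale (*) (\<lambda>x. x ?T)"
    by (simp add: Vector_Spaces.linear_iff tscale_def vector_space_field vector_space_tscale)
  note intros = linear_intros linear_tens3 vs g k st F T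
  have left: "\<phi>' (tensor_lift sA sW (\<lambda>a w. tensor_lift sU sV (\<lambda>u v. G u v w) (g a)) s) =
      tensor_lift sA sW (\<lambda>a w. tensor_lift sU sV (\<lambda>u v. \<phi>' (G u v w)) (g a)) s"
    and right: "\<phi>' (tensor_lift sU sC (\<lambda>u c. tensor_lift sV sW (\<lambda>v w. G u v w) (k c)) t) =
      tensor_lift sU sC (\<lambda>u c. tensor_lift sV sW (\<lambda>v w. \<phi>' (G u v w)) (k c)) t"
    if "Vector_Spaces.linear sQ (*) \<phi>'" "\<And>v w. Vector_Spaces.linear sU sQ (\<lambda>u. G u v w)"
      "\<And>u w. Vector_Spaces.linear sV sQ (\<lambda>v. G u v w)"
      "\<And>u v. Vector_Spaces.linear sW sQ (\<lambda>w. G u v w)"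
    for sQ :: "'k \<Rightarrow> 'q::ab_group_add \<Rightarrow> 'q" and \<phi>' G
    by (((subst linear_tensor_lift[OF that(1)], (intro intros that)+)+, rule refl)+)
  have "\<phi> (tensor_lift sA sW (\<lambda>a w. tensor_lift sU sV (\<lambda>u v. F u v w) (g a)) s) =
      tensor_lift sA sW (\<lambda>a w. tensor_lift sU sV (\<lambda>u v. tens3 sU sV sW u v w) (g a)) s ?T"
    by (subst left[OF ev], (intro intros)+, subst left[OF \<phi>], (intro intros)+)
      (simp add: tens3_def tri)
  also have "\<dots> = \<phi> (tensor_lift sU sC (\<lambda>u c. tensor_lift sV sW (\<lambda>v w. F u v w) (k c)) t)"
    unfolding eq
    by (subst right[OF ev], (intro intros)+, subst right[OF \<phi>], (intro intros)+)
      (simp add: tens3_def tri)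
  finally show "\<phi> (tensor_lift sA sW (\<lambda>a w. tensor_lift sU sV (\<lambda>u v. F u v w) (g a)) s) =
      \<phi> (tensor_lift sU sC (\<lambda>u c. tensor_lift sV sW (\<lambda>v w. F u v w) (k c)) t)" .
qed


lemma tensor_lift_cong:
  assumes "\<And>v w. f v w = g v w"
  shows "tensor_lift sV sW f t = tensor_lift sV sW g t"
proof -
  have "f = g" using assms by (intro ext)
  then show ?thesis by simp
qed

lemma scale_tensor_lift_left:
  assumes "vector_space sP" "bilinear_map sV sW (*) f" "t \<in> tensor_space sV sW"
  shows "sP (tensor_lift sV sW f t) p = tensor_lift sV sW (\<lambda>v w. sP (f v w) p) t"
  by (rule linear_tensor_lift[where \<phi> = "\<lambda>c. sP c p" and sP = "(*)" and sQ = sP])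
    (intro linear_intros assms)+

lemma scale_tensor_lift_right:
  assumes "bilinear_map sV sW sP f" "t \<in> tensor_space sV sW"
  shows "sP c (tensor_lift sV sW f t) = tensor_lift sV sW (\<lambda>v w. sP c (f v w)) t"
  by (rule linear_tensor_lift[where \<phi> = "sP c" and sP = sP and sQ = sP])
    (intro linear_intros assms vector_space_of_bilinear(3)[OF assms(1)])+

lemma tens_scale:
  assumes "vector_space sV" "vector_space sW"
  shows "tens sV sW (sV c v) w = tscale c (tens sV sW v w)"
    and "tens sV sW v (sW c w) = tscale c (tens sV sW v w)"
  using bilinear_map_tens[OF assms] by (simp_all add: bilinear_map_def Vector_Spaces.linear_iff)


section \<open>Sweedler calculus\<close>

context hopf_algebra
begin

lemmas [linear_intros] = vector_space_H comult_space
  linear_compose[OF comult_linear] linear_compose[OF counit_linear]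

lemma bilinear_mult: "bilinear_map (hscale H) (hscale H) (hscale H) (*)"
  by (simp add: bilinear_map_def Vector_Spaces.linear_iff vector_space_H scale_mult_left
      scale_mult_right[symmetric] distrib_left distrib_right)

lemmas [linear_intros] =
  bilinear_compose_left[OF bilinear_mult] bilinear_compose_right[OF bilinear_mult]

end

context coquasitriangular_hopf_algebra
begin

lemmas [linear_intros] =
  bilinear_compose_left[OF braiding_bilinear] bilinear_compose_right[OF braiding_bilinear]

end

text \<open>A bicomodule over a coquasitriangular Hopf algebra.\<close>

locale coquasitriangular_bicomodule = coquasitriangular_hopf_algebra H \<zeta> + bicomodule H M
  for H :: "('k::field, 'h::ring_1) hopf_data" and \<zeta> :: "'h \<Rightarrow> 'h \<Rightarrow> 'k"
    and M :: "('k, 'h, 'm::ab_group_add) bicomodule_data"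
begin

lemmas [linear_intros] = vector_space_M lcoact_space rcoact_space
  linear_compose[OF lcoact_linear] linear_compose[OF rcoact_linear]

text \<open>Coassociativity and compatibility of the coactions, for arbitrary trilinear summands.\<close>

lemma swl_coassoc:
  assumes "\<And>v w. Vector_Spaces.linear (hscale H) sP (\<lambda>u. F u v w)"
    "\<And>u w. Vector_Spaces.linear (hscale H) sP (\<lambda>v. F u v w)"
    "\<And>u v. Vector_Spaces.linear (vscale M) sP (\<lambda>w. F u v w)"
  shows "swl H M m (\<lambda>a w. sw H a (\<lambda>u v. F u v w)) = swl H M m (\<lambda>u c. swl H M c (\<lambda>v w. F u v w))"
  by (rule tens3_identity_transfer[where sP = sP, OF lcoact_coassoc]) (intro linear_intros assms)+

lemma swr_coassoc:
  assumes "\<And>v w. Vector_Spaces.linear (vscale M) sP (\<lambda>u. F u v w)"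
    "\<And>u w. Vector_Spaces.linear (hscale H) sP (\<lambda>v. F u v w)"
    "\<And>u v. Vector_Spaces.linear (hscale H) sP (\<lambda>w. F u v w)"
  shows "swr H M m (\<lambda>c w. swr H M c (\<lambda>u v. F u v w)) = swr H M m (\<lambda>u a. sw H a (\<lambda>v w. F u v w))"
  by (rule tens3_identity_transfer[where sP = sP, OF rcoact_coassoc[symmetric]])
    (intro linear_intros assms)+

lemma swr_swl:
  assumes "\<And>v w. Vector_Spaces.linear (hscale H) sP (\<lambda>u. F u v w)"
    "\<And>u w. Vector_Spaces.linear (vscale M) sP (\<lambda>v. F u v w)"
    "\<And>u v. Vector_Spaces.linear (hscale H) sP (\<lambda>w. F u v w)"
  shows "swr H M m (\<lambda>c w. swl H M c (\<lambda>u v. F u v w)) = swl H M m (\<lambda>u c. swr H M c (\<lambda>v w. F u v w))"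
  by (rule tens3_identity_transfer[where sP = sP, OF coact_commute[symmetric]])
    (intro linear_intros assms)+

lemma swl_counit:
  assumes "Vector_Spaces.linear (vscale M) sP f"
  shows "swl H M m (\<lambda>a m0. sP (counit H a) (f m0)) = f m"
proof -
  have "f m = f (swl H M m (\<lambda>a m0. vscale M (counit H a) m0))" by (simp only: lcoact_counit)
  also have "\<dots> = swl H M m (\<lambda>a m0. f (vscale M (counit H a) m0))"
    by (rule linear_tensor_lift[OF assms]) (intro linear_intros)+
  finally show ?thesis using assms by (simp add: Vector_Spaces.linear_iff)
qed

lemma swr_counit:
  assumes "Vector_Spaces.linear (vscale M) sP f"
  shows "swr H M m (\<lambda>m0 a. sP (counit H a) (f m0)) = f m"
proof -
  have "f m = f (swr H M m (\<lambda>m0 a. vscale M (counit H a) m0))" by (simp only: rcoact_counit)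
  also have "\<dots> = swr H M m (\<lambda>m0 a. f (vscale M (counit H a) m0))"
    by (rule linear_tensor_lift[OF assms]) (intro linear_intros)+
  finally show ?thesis using assms by (simp add: Vector_Spaces.linear_iff)
qed

end


section \<open>The Yetter-Drinfel'd-Long bimodule of a bicomodule\<close>

lemma with_braiding_actions_simps [simp]:
  "vscale (with_braiding_actions H \<zeta> M) = vscale M"
  "lcoact (with_braiding_actions H \<zeta> M) = lcoact M"
  "rcoact (with_braiding_actions H \<zeta> M) = rcoact M"
  by (simp_all add: with_braiding_actions_def)

lemma braiding_actions:
  "lact (with_braiding_actions H \<zeta> M) h m = swl H M m (\<lambda>a m0. vscale M (\<zeta> h a) m0)"
  "ract (with_braiding_actions H \<zeta> M) m h = swr H M m (\<lambda>m0 b. vscale M (\<zeta> h b) m0)"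
  by (simp_all add: with_braiding_actions_def)

context coquasitriangular_bicomodule
begin

abbreviation left_action :: "'h \<Rightarrow> 'm \<Rightarrow> 'm" (infixr "\<rhd>" 75) where
  "h \<rhd> m \<equiv> lact (with_braiding_actions H \<zeta> M) h m"

abbreviation right_action :: "'m \<Rightarrow> 'h \<Rightarrow> 'm" (infixl "\<lhd>" 76) where
  "m \<lhd> h \<equiv> ract (with_braiding_actions H \<zeta> M) m h"

lemma bilinear_left_action: "bilinear_map (hscale H) (vscale M) (vscale M) (\<rhd>)"
  unfolding braiding_actions by (intro linear_intros)

lemma bilinear_right_action: "bilinear_map (vscale M) (hscale H) (vscale M) (\<lhd>)"
  unfolding braiding_actions by (intro linear_intros)

lemmas [linear_intros] =
  bilinear_compose_left[OF bilinear_left_action] bilinear_compose_right[OF bilinear_left_action]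
  bilinear_compose_left[OF bilinear_right_action] bilinear_compose_right[OF bilinear_right_action]

text \<open>A linear map f satisfies \<open>f(h \<rhd> m) = \<zeta>(h, m\<^sub>-\<^sub>1) f(m\<^sub>0)\<close>, and similarly on the right.\<close>

lemma linear_left_action:
  assumes "Vector_Spaces.linear (vscale M) sP f"
  shows "f (h \<rhd> m) = swl H M m (\<lambda>a m0. sP (\<zeta> h a) (f m0))"
proof -
  have "f (h \<rhd> m) = swl H M m (\<lambda>a m0. f (vscale M (\<zeta> h a) m0))"
    unfolding braiding_actions by (rule linear_tensor_lift[OF assms]) (intro linear_intros)+
  then show ?thesis using assms by (simp add: Vector_Spaces.linear_iff)
qed

lemma linear_right_action:
  assumes "Vector_Spaces.linear (vscale M) sP f"
  shows "f (m \<lhd> h) = swr H M m (\<lambda>m0 b. sP (\<zeta> h b) (f m0))"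
proof -
  have "f (m \<lhd> h) = swr H M m (\<lambda>m0 b. f (vscale M (\<zeta> h b) m0))"
    unfolding braiding_actions by (rule linear_tensor_lift[OF assms]) (intro linear_intros)+
  then show ?thesis using assms by (simp add: Vector_Spaces.linear_iff)
qed

text \<open>
  The coactions of \<open>h \<rhd> m\<close> and \<open>m \<lhd> h\<close>, evaluated on a bilinear map. An action splits the coaction on
  its own side, while the coaction on the other side passes through it.
\<close>

lemma swl_left_action:
  assumes "bilinear_map (hscale H) (vscale M) sP F"
  shows "swl H M (h \<rhd> m) F = swl H M m (\<lambda>a m0. sw H a (\<lambda>a1 a2. sP (\<zeta> h a1) (F a2 m0)))"
proof -
  note intros = linear_intros assms vector_space_of_bilinear(3)[OF assms]
    bilinear_compose_left[OF assms] bilinear_compose_right[OF assms]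
  have "swl H M (h \<rhd> m) F = swl H M m (\<lambda>a m0. sP (\<zeta> h a) (swl H M m0 F))"
    by (rule linear_left_action[where sP = sP]) (intro intros)
  also have "\<dots> = swl H M m (\<lambda>a m0. swl H M m0 (\<lambda>b m00. sP (\<zeta> h a) (F b m00)))"
    by (intro tensor_lift_cong scale_tensor_lift_right[where sP = sP] intros)
  also have "\<dots> = swl H M m (\<lambda>a m0. sw H a (\<lambda>a1 a2. sP (\<zeta> h a1) (F a2 m0)))"
    by (rule swl_coassoc[where sP = sP, symmetric]) (intro intros)+
  finally show ?thesis .
qed

lemma swr_right_action:
  assumes "bilinear_map (vscale M) (hscale H) sP F"
  shows "swr H M (m \<lhd> h) F = swr H M m (\<lambda>m0 b. sw H b (\<lambda>b1 b2. sP (\<zeta> h b2) (F m0 b1)))"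
proof -
  note intros = linear_intros assms vector_space_of_bilinear(3)[OF assms]
    bilinear_compose_left[OF assms] bilinear_compose_right[OF assms]
  have "swr H M (m \<lhd> h) F = swr H M m (\<lambda>m0 b. sP (\<zeta> h b) (swr H M m0 F))"
    by (rule linear_right_action[where sP = sP]) (intro intros)
  also have "\<dots> = swr H M m (\<lambda>m0 b. swr H M m0 (\<lambda>m00 c. sP (\<zeta> h b) (F m00 c)))"
    by (intro tensor_lift_cong scale_tensor_lift_right[where sP = sP] intros)
  also have "\<dots> = swr H M m (\<lambda>m0 b. sw H b (\<lambda>b1 b2. sP (\<zeta> h b2) (F m0 b1)))"
    by (rule swr_coassoc[where sP = sP]) (intro intros)+
  finally show ?thesis .
qed

lemma swr_left_action:
  assumes "bilinear_map (vscale M) (hscale H) sP F"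
  shows "swr H M (h \<rhd> m) F = swr H M m (\<lambda>m0 b. F (h \<rhd> m0) b)"
proof -
  note intros = linear_intros assms vector_space_of_bilinear(3)[OF assms]
    bilinear_compose_left[OF assms] bilinear_compose_right[OF assms]
  have "swr H M (h \<rhd> m) F = swl H M m (\<lambda>a m0. sP (\<zeta> h a) (swr H M m0 F))"
    by (rule linear_left_action[where sP = sP]) (intro intros)
  also have "\<dots> = swl H M m (\<lambda>a m0. swr H M m0 (\<lambda>m00 b. sP (\<zeta> h a) (F m00 b)))"
    by (intro tensor_lift_cong scale_tensor_lift_right[where sP = sP] intros)
  also have "\<dots> = swr H M m (\<lambda>m0 b. swl H M m0 (\<lambda>a m00. sP (\<zeta> h a) (F m00 b)))"
    by (rule swr_swl[where sP = sP, symmetric]) (intro intros)+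
  also have "\<dots> = swr H M m (\<lambda>m0 b. F (h \<rhd> m0) b)"
    by (intro tensor_lift_cong linear_left_action[where sP = sP, symmetric] intros)
  finally show ?thesis .
qed

lemma swl_right_action:
  assumes "bilinear_map (hscale H) (vscale M) sP F"
  shows "swl H M (m \<lhd> h) F = swl H M m (\<lambda>a m0. F a (m0 \<lhd> h))"
proof -
  note intros = linear_intros assms vector_space_of_bilinear(3)[OF assms]
    bilinear_compose_left[OF assms] bilinear_compose_right[OF assms]
  have "swl H M (m \<lhd> h) F = swr H M m (\<lambda>m0 b. sP (\<zeta> h b) (swl H M m0 F))"
    by (rule linear_right_action[where sP = sP]) (intro intros)
  also have "\<dots> = swr H M m (\<lambda>m0 b. swl H M m0 (\<lambda>a m00. sP (\<zeta> h b) (F a m00)))"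
    by (intro tensor_lift_cong scale_tensor_lift_right[where sP = sP] intros)
  also have "\<dots> = swl H M m (\<lambda>a m0. swr H M m0 (\<lambda>m00 b. sP (\<zeta> h b) (F a m00)))"
    by (rule swr_swl[where sP = sP]) (intro intros)+
  also have "\<dots> = swl H M m (\<lambda>a m0. F a (m0 \<lhd> h))"
    by (intro tensor_lift_cong linear_right_action[where sP = sP, symmetric] intros)
  finally show ?thesis .
qed

lemma left_action_mult: "(h * g) \<rhd> m = h \<rhd> (g \<rhd> m)"
proof -
  interpret V: vector_space "vscale M" by (rule vector_space_M)
  have "(h * g) \<rhd> m = swl H M m (\<lambda>a m0. sw H a (\<lambda>a1 a2. vscale M (\<zeta> h a2 * \<zeta> g a1) m0))"
    unfolding braiding_actions braiding_mult_left
    by (intro tensor_lift_cong scale_tensor_lift_left[where sP = "vscale M"] linear_intros)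
  also have "\<dots> = swl H M m (\<lambda>a m0. sw H a (\<lambda>a1 a2. vscale M (\<zeta> g a1) (vscale M (\<zeta> h a2) m0)))"
    by (simp add: mult.commute)
  also have "\<dots> = swl H M (g \<rhd> m) (\<lambda>b m0. vscale M (\<zeta> h b) m0)"
    by (rule swl_left_action[where sP = "vscale M", symmetric]) (intro linear_intros)
  finally show ?thesis by (simp only: braiding_actions(1)[of _ _ _ h])
qed

lemma right_action_mult: "m \<lhd> (h * g) = m \<lhd> h \<lhd> g"
proof -
  interpret V: vector_space "vscale M" by (rule vector_space_M)
  have "m \<lhd> (h * g) = swr H M m (\<lambda>m0 b. sw H b (\<lambda>b1 b2. vscale M (\<zeta> h b2 * \<zeta> g b1) m0))"
    unfolding braiding_actions braiding_mult_left
    by (intro tensor_lift_cong scale_tensor_lift_left[where sP = "vscale M"] linear_intros)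
  also have "\<dots> = swr H M m (\<lambda>m0 b. sw H b (\<lambda>b1 b2. vscale M (\<zeta> h b2) (vscale M (\<zeta> g b1) m0)))"
    by simp
  also have "\<dots> = swr H M (m \<lhd> h) (\<lambda>m0 b. vscale M (\<zeta> g b) m0)"
    by (rule swr_right_action[where sP = "vscale M", symmetric]) (intro linear_intros)
  finally show ?thesis by (simp only: braiding_actions(2)[of _ _ _ _ g])
qed

lemma actions_commute: "(h \<rhd> m) \<lhd> g = h \<rhd> (m \<lhd> g)"
proof -
  interpret V: vector_space "vscale M" by (rule vector_space_M)
  have "(h \<rhd> m) \<lhd> g = swr H M m (\<lambda>m0 b. vscale M (\<zeta> g b) (h \<rhd> m0))"
    unfolding braiding_actions(2) by (rule swr_left_action[where sP = "vscale M"]) (intro linear_intros)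
  also have "\<dots> = h \<rhd> (m \<lhd> g)"
    by (rule linear_right_action[where sP = "vscale M", symmetric]) (intro linear_intros)
  finally show ?thesis .
qed

text \<open>
  Both sides have the form \<open>x \<otimes> m\<^sub>0\<close> with x a sum over the coproducts of h and \<open>m\<^sub>-\<^sub>1\<close>, and the two sums
  agree by the commutation axiom of the braiding. The right-hand version below is analogous.
\<close>

lemma left_action_lcoact:
  "sw H h (\<lambda>h1 h2. swl H M (h1 \<rhd> m) (\<lambda>a n. tens (hscale H) (vscale M) (a * h2) n)) =
   sw H h (\<lambda>h1 h2. swl H M m (\<lambda>a m0. tens (hscale H) (vscale M) (h1 * a) (h2 \<rhd> m0)))"
proof -
  let ?t = "tens (hscale H) (vscale M)"
  note tens_scale = tens_scale[OF vector_space_H vector_space_M, symmetric]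
  \<comment> \<open>The coaction can be summed outermost, with the sums over coproducts inside the tensor factor.\<close>
  have pull: "sw H h (\<lambda>h1 h2. swl H M m (\<lambda>a m0. sw H a (\<lambda>a1 a2. ?t (F h1 h2 a1 a2) m0))) =
      swl H M m (\<lambda>a m0. ?t (sw H h (\<lambda>h1 h2. sw H a (F h1 h2))) m0)"
    if F: "\<And>h2 a1 a2. Vector_Spaces.linear (hscale H) (hscale H) (\<lambda>h1. F h1 h2 a1 a2)"
      "\<And>h1 a1 a2. Vector_Spaces.linear (hscale H) (hscale H) (\<lambda>h2. F h1 h2 a1 a2)"
      "\<And>h1 h2 a2. Vector_Spaces.linear (hscale H) (hscale H) (\<lambda>a1. F h1 h2 a1 a2)"
      "\<And>h1 h2 a1. Vector_Spaces.linear (hscale H) (hscale H) (\<lambda>a2. F h1 h2 a1 a2)" for F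
  proof -
    have "sw H h (\<lambda>h1 h2. swl H M m (\<lambda>a m0. sw H a (\<lambda>a1 a2. ?t (F h1 h2 a1 a2) m0))) =
        swl H M m (\<lambda>a m0. sw H h (\<lambda>h1 h2. sw H a (\<lambda>a1 a2. ?t (F h1 h2 a1 a2) m0)))"
      by (rule tensor_lift_swap[where sP = tscale]) (intro linear_intros F)+
    also have "\<dots> = swl H M m (\<lambda>a m0. sw H h (\<lambda>h1 h2. ?t (sw H a (F h1 h2)) m0))"
      by (intro tensor_lift_cong linear_intros F
          linear_tensor_lift[where sP = "hscale H" and sQ = tscale and \<phi> = "\<lambda>x. ?t x _", symmetric])
    also have "\<dots> = swl H M m (\<lambda>a m0. ?t (sw H h (\<lambda>h1 h2. sw H a (F h1 h2))) m0)"
      by (intro tensor_lift_cong linear_intros F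
          linear_tensor_lift[where sP = "hscale H" and sQ = tscale and \<phi> = "\<lambda>x. ?t x _", symmetric])
    finally show ?thesis .
  qed
  have "sw H h (\<lambda>h1 h2. swl H M (h1 \<rhd> m) (\<lambda>a n. ?t (a * h2) n)) =
      sw H h (\<lambda>h1 h2. swl H M m (\<lambda>a m0. sw H a (\<lambda>a1 a2. tscale (\<zeta> h1 a1) (?t (a2 * h2) m0))))"
    by (intro tensor_lift_cong swl_left_action[where sP = tscale] linear_intros)
  also have "\<dots> = swl H M m (\<lambda>a m0. ?t
      (sw H h (\<lambda>h1 h2. sw H a (\<lambda>a1 a2. hscale H (\<zeta> h1 a1) (a2 * h2)))) m0)"
    unfolding tens_scale(1) by (rule pull) (intro linear_intros)+
  also have "\<dots> = swl H M m (\<lambda>a m0. ?t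
      (sw H h (\<lambda>h1 h2. sw H a (\<lambda>a1 a2. hscale H (\<zeta> h2 a2) (h1 * a1)))) m0)"
    by (simp only: braiding_commute)
  also have "\<dots> = sw H h (\<lambda>h1 h2. swl H M m (\<lambda>a m0. sw H a
      (\<lambda>a1 a2. tscale (\<zeta> h2 a2) (?t (h1 * a1) m0))))"
    unfolding tens_scale(1) by (rule pull[symmetric]) (intro linear_intros)+
  also have "\<dots> = sw H h (\<lambda>h1 h2. swl H M m (\<lambda>a m0. swl H M m0
      (\<lambda>b m00. tscale (\<zeta> h2 b) (?t (h1 * a) m00))))"
    by (rule tensor_lift_cong, rule swl_coassoc[where sP = tscale]) (intro linear_intros)+
  also have "\<dots> = sw H h (\<lambda>h1 h2. swl H M m (\<lambda>a m0. ?t (h1 * a) (h2 \<rhd> m0)))"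
    by (intro tensor_lift_cong linear_left_action[where sP = tscale, symmetric] linear_intros)
  finally show ?thesis .
qed

lemma right_action_rcoact:
  "sw H h (\<lambda>h1 h2. swr H M (m \<lhd> h2) (\<lambda>n b. tens (vscale M) (hscale H) n (h1 * b))) =
   sw H h (\<lambda>h1 h2. swr H M m (\<lambda>m0 b. tens (vscale M) (hscale H) (m0 \<lhd> h1) (b * h2)))"
proof -
  let ?t = "tens (vscale M) (hscale H)"
  note tens_scale = tens_scale[OF vector_space_M vector_space_H, symmetric]
  \<comment> \<open>The coaction can be summed outermost, with the sums over coproducts inside the tensor factor.\<close>
  have pull: "sw H h (\<lambda>h1 h2. swr H M m (\<lambda>m0 b. sw H b (\<lambda>b1 b2. ?t m0 (F h1 h2 b1 b2)))) =
      swr H M m (\<lambda>m0 b. ?t m0 (sw H h (\<lambda>h1 h2. sw H b (F h1 h2))))"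
    if F: "\<And>h2 a1 a2. Vector_Spaces.linear (hscale H) (hscale H) (\<lambda>h1. F h1 h2 a1 a2)"
      "\<And>h1 a1 a2. Vector_Spaces.linear (hscale H) (hscale H) (\<lambda>h2. F h1 h2 a1 a2)"
      "\<And>h1 h2 a2. Vector_Spaces.linear (hscale H) (hscale H) (\<lambda>a1. F h1 h2 a1 a2)"
      "\<And>h1 h2 a1. Vector_Spaces.linear (hscale H) (hscale H) (\<lambda>a2. F h1 h2 a1 a2)" for F
  proof -
    have "sw H h (\<lambda>h1 h2. swr H M m (\<lambda>m0 b. sw H b (\<lambda>b1 b2. ?t m0 (F h1 h2 b1 b2)))) =
        swr H M m (\<lambda>m0 b. sw H h (\<lambda>h1 h2. sw H b (\<lambda>b1 b2. ?t m0 (F h1 h2 b1 b2))))"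
      by (rule tensor_lift_swap[where sP = tscale]) (intro linear_intros F)+
    also have "\<dots> = swr H M m (\<lambda>m0 b. sw H h (\<lambda>h1 h2. ?t m0 (sw H b (F h1 h2))))"
      by (intro tensor_lift_cong linear_intros F
          linear_tensor_lift[where sP = "hscale H" and sQ = tscale and \<phi> = "?t _", symmetric])
    also have "\<dots> = swr H M m (\<lambda>m0 b. ?t m0 (sw H h (\<lambda>h1 h2. sw H b (F h1 h2))))"
      by (intro tensor_lift_cong linear_intros F
          linear_tensor_lift[where sP = "hscale H" and sQ = tscale and \<phi> = "?t _", symmetric])
    finally show ?thesis .
  qed
  have "sw H h (\<lambda>h1 h2. swr H M (m \<lhd> h2) (\<lambda>n b. ?t n (h1 * b))) =
      sw H h (\<lambda>h1 h2. swr H M m (\<lambda>m0 b. sw H b (\<lambda>b1 b2. tscale (\<zeta> h2 b2) (?t m0 (h1 * b1)))))"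
    by (intro tensor_lift_cong swr_right_action[where sP = tscale] linear_intros)
  also have "\<dots> = swr H M m (\<lambda>m0 b. ?t m0
      (sw H h (\<lambda>h1 h2. sw H b (\<lambda>b1 b2. hscale H (\<zeta> h2 b2) (h1 * b1)))))"
    unfolding tens_scale(2) by (rule pull) (intro linear_intros)+
  also have "\<dots> = swr H M m (\<lambda>m0 b. ?t m0
      (sw H h (\<lambda>h1 h2. sw H b (\<lambda>b1 b2. hscale H (\<zeta> h1 b1) (b2 * h2)))))"
    by (simp only: braiding_commute)
  also have "\<dots> = sw H h (\<lambda>h1 h2. swr H M m (\<lambda>m0 b. sw H b
      (\<lambda>b1 b2. tscale (\<zeta> h1 b1) (?t m0 (b2 * h2)))))"
    unfolding tens_scale(2) by (rule pull[symmetric]) (intro linear_intros)+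
  also have "\<dots> = sw H h (\<lambda>h1 h2. swr H M m (\<lambda>m0 b. swr H M m0
      (\<lambda>m00 c. tscale (\<zeta> h1 c) (?t m00 (b * h2)))))"
    by (rule tensor_lift_cong, rule swr_coassoc[where sP = tscale, symmetric]) (intro linear_intros)+
  also have "\<dots> = sw H h (\<lambda>h1 h2. swr H M m (\<lambda>m0 b. ?t (m0 \<lhd> h1) (b * h2)))"
    by (intro tensor_lift_cong linear_right_action[where sP = tscale, symmetric] linear_intros)
  finally show ?thesis .
qed

theorem yd_long_bimodule_braiding_actions: "yd_long_bimodule H (with_braiding_actions H \<zeta> M)"
proof -
  have "bicomodule H (with_braiding_actions H \<zeta> M)"
    using bicomodule_axioms by (simp add: bicomodule_def)
  moreover have "rcoact M (h \<rhd> m) = swr H M m (\<lambda>m0 b. tens (vscale M) (hscale H) (h \<rhd> m0) b)" for h m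
    using swr_left_action[OF bilinear_map_tens, of h m]
    by (simp add: tensor_lift_tens vector_space_M vector_space_H rcoact_space)
  moreover have "lcoact M (m \<lhd> h) = swl H M m (\<lambda>a m0. tens (hscale H) (vscale M) a (m0 \<lhd> h))" for h m
    using swl_right_action[OF bilinear_map_tens, of m h]
    by (simp add: tensor_lift_tens vector_space_M vector_space_H lcoact_space)
  moreover have "1 \<rhd> m = m" "m \<lhd> 1 = m" for m
    by (simp_all add: braiding_actions braiding_one_left lcoact_counit rcoact_counit)
  ultimately show ?thesis
    by (simp add: yd_long_bimodule_def yd_long_bimodule_axioms_def bilinear_left_action
        bilinear_right_action left_action_mult right_action_mult actions_commute
        left_action_lcoact right_action_rcoact)
qed

end


section \<open>Symmetry of the braiding\<close>

text \<open>Two bicomodules over the same coquasitriangular Hopf algebra.\<close>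

locale coquasitriangular_bicomodule_pair =
  M: coquasitriangular_bicomodule H \<zeta> M + N: coquasitriangular_bicomodule H \<zeta> N
  for H :: "('k::field, 'h::ring_1) hopf_data" and \<zeta> :: "'h \<Rightarrow> 'h \<Rightarrow> 'k"
    and M :: "('k, 'h, 'm::ab_group_add) bicomodule_data"
    and N :: "('k, 'h, 'n::ab_group_add) bicomodule_data"
begin

text \<open>The bicomodules with the actions given by the braiding.\<close>

abbreviation "M' \<equiv> with_braiding_actions H \<zeta> M"
abbreviation "N' \<equiv> with_braiding_actions H \<zeta> N"

theorem yd_long_hom_braiding_actions:
  assumes f: "bicomodule_hom H M N f"
  shows "yd_long_hom H M' N' f"
proof -
  have lin: "Vector_Spaces.linear (vscale M) (vscale N) f"
    and lc: "lcoact N (f m) = swl H M m (\<lambda>a m0. tens (hscale H) (vscale N) a (f m0))"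
    and rc: "rcoact N (f m) = swr H M m (\<lambda>m0 a. tens (vscale N) (hscale H) (f m0) a)" for m
    using f by (simp_all add: bicomodule_hom_def)
  note intros = linear_intros linear_compose[OF lin]
  have "f (lact M' h m) = lact N' h (f m)" for h m
  proof -
    have "lact N' h (f m) = swl H M m (\<lambda>a m0. tensor_lift (hscale H) (vscale N)
        (\<lambda>a n. vscale N (\<zeta> h a) n) (tens (hscale H) (vscale N) a (f m0)))"
      unfolding braiding_actions lc
      by (rule tensor_lift_nested[where sP = "vscale N"]) (intro intros)+
    also have "\<dots> = swl H M m (\<lambda>a m0. vscale N (\<zeta> h a) (f m0))"
      by (intro tensor_lift_cong tensor_lift_pure[where sP = "vscale N"] intros)
    also have "\<dots> = f (lact M' h m)"
      by (rule M.linear_left_action[OF lin, symmetric])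
    finally show ?thesis ..
  qed
  moreover have "f (ract M' m h) = ract N' (f m) h" for h m
  proof -
    have "ract N' (f m) h = swr H M m (\<lambda>m0 b. tensor_lift (vscale N) (hscale H)
        (\<lambda>n b. vscale N (\<zeta> h b) n) (tens (vscale N) (hscale H) (f m0) b))"
      unfolding braiding_actions rc
      by (rule tensor_lift_nested[where sP = "vscale N"]) (intro intros)+
    also have "\<dots> = swr H M m (\<lambda>m0 b. vscale N (\<zeta> h b) (f m0))"
      by (intro tensor_lift_cong tensor_lift_pure[where sP = "vscale N"] intros)
    also have "\<dots> = f (ract M' m h)"
      by (rule M.linear_right_action[OF lin, symmetric])
    finally show ?thesis ..
  qed
  moreover have "bicomodule_hom H M' N' f"
    using f by (simp add: bicomodule_hom_def)
  ultimately show ?thesis by (simp add: yd_long_hom_def)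
qed

text \<open>
  The value \<open>m\<^sub>-\<^sub>1 \<rhd> n\<^sub>0 \<otimes> m\<^sub>0 \<lhd> n\<^sub>1\<close> of the braiding at the pure tensor of m and n.
\<close>

definition pure_braiding :: "'m \<Rightarrow> 'n \<Rightarrow> ('k, 'n, 'm) tensor" where
  "pure_braiding m n = swl H M m (\<lambda>a m0. swr H N n (\<lambda>n0 b.
     tens (vscale N) (vscale M) (lact N' a n0) (ract M' m0 b)))"

lemma bilinear_pure_braiding: "bilinear_map (vscale M) (vscale N) tscale pure_braiding"
  unfolding pure_braiding_def by (intro linear_intros)

lemma pure_braiding_in_tensor_space:
  "pure_braiding m n \<in> tensor_space (vscale N) (vscale M)"
  unfolding pure_braiding_def
  by (intro tensor_lift_in_tensor_space linear_intros)

lemma yd_long_braiding_eq: "yd_long_braiding H M' N' = tensor_lift (vscale M) (vscale N) pure_braiding"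
  by (simp add: yd_long_braiding_def pure_braiding_def[abs_def])

lemma tensor_lift_pure_braiding:
  assumes F: "bilinear_map (vscale N) (vscale M) sP F"
  shows "tensor_lift (vscale N) (vscale M) F (pure_braiding m n) =
    swl H M m (\<lambda>a m0. swr H N n (\<lambda>n0 b. F (lact N' a n0) (ract M' m0 b)))"
proof -
  let ?t = "tens (vscale N) (vscale M)"
  have "tensor_lift (vscale N) (vscale M) F (pure_braiding m n) =
      swl H M m (\<lambda>a m0. tensor_lift (vscale N) (vscale M) F
        (swr H N n (\<lambda>n0 b. ?t (lact N' a n0) (ract M' m0 b))))"
    unfolding pure_braiding_def
    by (rule tensor_lift_nested[OF F]) (intro tensor_lift_in_tensor_space linear_intros)+
  also have "\<dots> = swl H M m (\<lambda>a m0. swr H N n (\<lambda>n0 b.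
      tensor_lift (vscale N) (vscale M) F (?t (lact N' a n0) (ract M' m0 b))))"
    by (intro tensor_lift_cong tensor_lift_nested[OF F] linear_intros)
  also have "\<dots> = swl H M m (\<lambda>a m0. swr H N n (\<lambda>n0 b. F (lact N' a n0) (ract M' m0 b)))"
    by (simp only: tensor_lift_pure[OF F])
  finally show ?thesis .
qed

end

context cotriangular_hopf_algebra
begin

text \<open>The cotriangularity axiom with scalars acting on a vector p.\<close>

lemma cotriangular_cancel:
  assumes "vector_space sP"
  shows "sw H h (\<lambda>h1 h2. sw H g (\<lambda>g1 g2. sP (\<zeta> h1 g1) (sP (\<zeta> g2 h2) p))) =
    sP (counit H g) (sP (counit H h) p)"
proof -
  interpret P: vector_space sP by fact
  have "sP (counit H g) (sP (counit H h) p) =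
      sP (sw H h (\<lambda>h1 h2. sw H g (\<lambda>g1 g2. \<zeta> h1 g1 * \<zeta> g2 h2))) p"
    by (simp add: cotriangular)
  also have "\<dots> = sw H h (\<lambda>h1 h2. sP (sw H g (\<lambda>g1 g2. \<zeta> h1 g1 * \<zeta> g2 h2)) p)"
    by (intro scale_tensor_lift_left[where sP = sP] linear_intros assms)
  also have "\<dots> = sw H h (\<lambda>h1 h2. sw H g (\<lambda>g1 g2. sP (\<zeta> h1 g1 * \<zeta> g2 h2) p))"
    by (intro tensor_lift_cong scale_tensor_lift_left[where sP = sP] linear_intros assms)
  finally show ?thesis by simp
qed

end

text \<open>Two bicomodules over the same cotriangular Hopf algebra.\<close>

locale cotriangular_bicomodule_pair =
  cotriangular_hopf_algebra H \<zeta> + coquasitriangular_bicomodule_pair H \<zeta> M N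
  for H :: "('k::field, 'h::ring_1) hopf_data" and \<zeta> :: "'h \<Rightarrow> 'h \<Rightarrow> 'k"
    and M :: "('k, 'h, 'm::ab_group_add) bicomodule_data"
    and N :: "('k, 'h, 'n::ab_group_add) bicomodule_data"
begin

text \<open>
  Expanding the actions gives \<open>F(m\<^sub>0, n\<^sub>0)\<close> with coefficient \<open>\<zeta>(a\<^sub>1, b\<^sub>1) \<zeta>(b\<^sub>2, a\<^sub>2)\<close>, where a and b are the
  left coaction components of m and n. Sums over coactions of different modules are exchanged until
  the two coactions of m are adjacent and can be merged by coassociativity.
\<close>

lemma left_braiding_cancel:
  assumes F: "bilinear_map (vscale M) (vscale N) sP F"
  shows "swl H M m (\<lambda>a m0. swl H N (lact N' a n) (\<lambda>c n0. F (lact M' c m0) n0)) = F m n"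
proof -
  have P: "vector_space sP" by (rule vector_space_of_bilinear(3)[OF F])
  note intros = linear_intros bilinear_compose_left[OF F] bilinear_compose_right[OF F] P
  have "swl H M m (\<lambda>a m0. swl H N (lact N' a n) (\<lambda>c n0. F (lact M' c m0) n0)) =
      swl H M m (\<lambda>a m0. swl H N n (\<lambda>b n0. sw H b (\<lambda>b1 b2.
        sP (\<zeta> a b1) (F (lact M' b2 m0) n0))))"
    by (intro tensor_lift_cong N.swl_left_action[where sP = sP] intros)
  also have "\<dots> = swl H M m (\<lambda>a m0. swl H N n (\<lambda>b n0. sw H b (\<lambda>b1 b2.
        swl H M m0 (\<lambda>d m00. sP (\<zeta> b2 d) (sP (\<zeta> a b1) (F m00 n0))))))"
    by (intro tensor_lift_cong M.linear_left_action[where sP = sP] intros)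
  also have "\<dots> = swl H N n (\<lambda>b n0. swl H M m (\<lambda>a m0. sw H b (\<lambda>b1 b2.
        swl H M m0 (\<lambda>d m00. sP (\<zeta> b2 d) (sP (\<zeta> a b1) (F m00 n0))))))"
    by (rule tensor_lift_swap[where sP = sP]) (intro intros)+
  also have "\<dots> = swl H N n (\<lambda>b n0. sw H b (\<lambda>b1 b2. swl H M m (\<lambda>a m0.
        swl H M m0 (\<lambda>d m00. sP (\<zeta> b2 d) (sP (\<zeta> a b1) (F m00 n0))))))"
    by (rule tensor_lift_cong, rule tensor_lift_swap[where sP = sP]) (intro intros)+
  also have "\<dots> = swl H N n (\<lambda>b n0. sw H b (\<lambda>b1 b2. swl H M m (\<lambda>a m0.
        sw H a (\<lambda>a1 a2. sP (\<zeta> b2 a2) (sP (\<zeta> a1 b1) (F m0 n0))))))"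
    by (rule tensor_lift_cong, rule tensor_lift_cong, rule M.swl_coassoc[where sP = sP, symmetric])
      (intro intros)+
  also have "\<dots> = swl H N n (\<lambda>b n0. swl H M m (\<lambda>a m0. sw H b (\<lambda>b1 b2.
        sw H a (\<lambda>a1 a2. sP (\<zeta> b2 a2) (sP (\<zeta> a1 b1) (F m0 n0))))))"
    by (rule tensor_lift_cong, rule tensor_lift_swap[where sP = sP]) (intro intros)+
  also have "\<dots> = swl H N n (\<lambda>b n0. swl H M m (\<lambda>a m0. sw H a (\<lambda>a1 a2.
        sw H b (\<lambda>b1 b2. sP (\<zeta> b2 a2) (sP (\<zeta> a1 b1) (F m0 n0))))))"
    by (rule tensor_lift_cong, rule tensor_lift_cong, rule tensor_lift_swap[where sP = sP])
      (intro intros)+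
  also have "\<dots> = swl H N n (\<lambda>b n0. swl H M m (\<lambda>a m0.
        sP (counit H a) (sP (counit H b) (F m0 n0))))"
  proof -
    interpret P: vector_space sP by fact
    show ?thesis
      using cotriangular_cancel[OF P] by (simp add: mult.commute)
  qed
  also have "\<dots> = swl H N n (\<lambda>b n0. sP (counit H b) (F m n0))"
    by (intro tensor_lift_cong M.swl_counit[where sP = sP] intros)
  also have "\<dots> = F m n"
    by (intro N.swl_counit[where sP = sP] intros)
  finally show ?thesis .
qed

text \<open>
  The mirror image: the coefficient is \<open>\<zeta>(d\<^sub>1, b\<^sub>1) \<zeta>(b\<^sub>2, d\<^sub>2)\<close>, where d and b are the right coaction
  components of m and n.
\<close>

lemma right_braiding_cancel:
  assumes F: "bilinear_map (vscale M) (vscale N) sP F"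
  shows "swr H N n (\<lambda>n0 b. swr H M (ract M' m b) (\<lambda>m0 d. F m0 (ract N' n0 d))) = F m n"
proof -
  have P: "vector_space sP" by (rule vector_space_of_bilinear(3)[OF F])
  note intros = linear_intros bilinear_compose_left[OF F] bilinear_compose_right[OF F] P
  have "swr H N n (\<lambda>n0 b. swr H M (ract M' m b) (\<lambda>m0 d. F m0 (ract N' n0 d))) =
      swr H N n (\<lambda>n0 b. swr H M m (\<lambda>m0 d. sw H d (\<lambda>d1 d2.
        sP (\<zeta> b d2) (F m0 (ract N' n0 d1)))))"
    by (intro tensor_lift_cong M.swr_right_action[where sP = sP] intros)
  also have "\<dots> = swr H N n (\<lambda>n0 b. swr H M m (\<lambda>m0 d. sw H d (\<lambda>d1 d2.
        swr H N n0 (\<lambda>n00 c. sP (\<zeta> d1 c) (sP (\<zeta> b d2) (F m0 n00))))))"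
    by (intro tensor_lift_cong N.linear_right_action[where sP = sP] intros)
  also have "\<dots> = swr H M m (\<lambda>m0 d. swr H N n (\<lambda>n0 b. sw H d (\<lambda>d1 d2.
        swr H N n0 (\<lambda>n00 c. sP (\<zeta> d1 c) (sP (\<zeta> b d2) (F m0 n00))))))"
    by (rule tensor_lift_swap[where sP = sP]) (intro intros)+
  also have "\<dots> = swr H M m (\<lambda>m0 d. sw H d (\<lambda>d1 d2. swr H N n (\<lambda>n0 b.
        swr H N n0 (\<lambda>n00 c. sP (\<zeta> d1 c) (sP (\<zeta> b d2) (F m0 n00))))))"
    by (rule tensor_lift_cong, rule tensor_lift_swap[where sP = sP]) (intro intros)+
  also have "\<dots> = swr H M m (\<lambda>m0 d. sw H d (\<lambda>d1 d2. swr H N n (\<lambda>n0 b.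
        sw H b (\<lambda>b1 b2. sP (\<zeta> d1 b1) (sP (\<zeta> b2 d2) (F m0 n0))))))"
    by (rule tensor_lift_cong, rule tensor_lift_cong, rule N.swr_coassoc[where sP = sP])
      (intro intros)+
  also have "\<dots> = swr H M m (\<lambda>m0 d. swr H N n (\<lambda>n0 b. sw H d (\<lambda>d1 d2.
        sw H b (\<lambda>b1 b2. sP (\<zeta> d1 b1) (sP (\<zeta> b2 d2) (F m0 n0))))))"
    by (rule tensor_lift_cong, rule tensor_lift_swap[where sP = sP]) (intro intros)+
  also have "\<dots> = swr H M m (\<lambda>m0 d. swr H N n (\<lambda>n0 b.
        sP (counit H b) (sP (counit H d) (F m0 n0))))"
    by (simp only: cotriangular_cancel[OF P])
  also have "\<dots> = swr H M m (\<lambda>m0 d. sP (counit H d) (F m0 n))"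
    by (intro tensor_lift_cong N.swr_counit[where sP = sP] intros)
  also have "\<dots> = F m n"
    by (intro M.swr_counit[where sP = sP] intros)
  finally show ?thesis .
qed

theorem yd_long_braiding_symmetric:
  assumes t: "t \<in> tensor_space (vscale M) (vscale N)"
  shows "yd_long_braiding H N' M' (yd_long_braiding H M' N' t) = t"
proof -
  interpret swapped: coquasitriangular_bicomodule_pair H \<zeta> N M ..
  let ?t = "tens (vscale M) (vscale N)"
  have pure: "tensor_lift (vscale N) (vscale M) swapped.pure_braiding (pure_braiding m n) = ?t m n"
    for m n
  proof -
    have "tensor_lift (vscale N) (vscale M) swapped.pure_braiding (pure_braiding m n) =
        swl H M m (\<lambda>a m0. swr H N n (\<lambda>n0 b. swl H N (lact N' a n0) (\<lambda>c n00.
          swr H M (ract M' m0 b) (\<lambda>m00 d. ?t (lact M' c m00) (ract N' n00 d)))))"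
      by (subst tensor_lift_pure_braiding[OF swapped.bilinear_pure_braiding])
        (simp only: swapped.pure_braiding_def)
    \<comment> \<open>The next two steps use that the left action on N is right colinear and that the coactions of N
      commute.\<close>
    also have "\<dots> = swl H M m (\<lambda>a m0. swr H N (lact N' a n) (\<lambda>n0 b. swl H N n0 (\<lambda>c n00.
          swr H M (ract M' m0 b) (\<lambda>m00 d. ?t (lact M' c m00) (ract N' n00 d)))))"
      by (rule tensor_lift_cong, rule N.swr_left_action[where sP = tscale, symmetric])
        (intro linear_intros)
    also have "\<dots> = swl H M m (\<lambda>a m0. swl H N (lact N' a n) (\<lambda>c n0. swr H N n0 (\<lambda>n00 b.
          swr H M (ract M' m0 b) (\<lambda>m00 d. ?t (lact M' c m00) (ract N' n00 d)))))"
      by (rule tensor_lift_cong, rule N.swr_swl[where sP = tscale]) (intro linear_intros)+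
    also have "\<dots> = swl H M m (\<lambda>a m0. swl H N (lact N' a n) (\<lambda>c n0. ?t (lact M' c m0) n0))"
      by (rule tensor_lift_cong, rule tensor_lift_cong, rule right_braiding_cancel[where sP = tscale])
        (intro linear_intros)
    also have "\<dots> = ?t m n"
      by (rule left_braiding_cancel[where sP = tscale]) (intro linear_intros)
    finally show ?thesis .
  qed
  have "yd_long_braiding H N' M' (yd_long_braiding H M' N' t) =
      tensor_lift (vscale M) (vscale N)
        (\<lambda>m n. tensor_lift (vscale N) (vscale M) swapped.pure_braiding (pure_braiding m n)) t"
    unfolding yd_long_braiding_eq swapped.yd_long_braiding_eq
    by (rule tensor_lift_nested[OF swapped.bilinear_pure_braiding bilinear_pure_braiding
          pure_braiding_in_tensor_space t])
  also have "\<dots> = tensor_lift (vscale M) (vscale N) ?t t"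
    by (simp only: pure)
  also have "\<dots> = t"
    by (rule tensor_lift_tens[OF M.vector_space_M N.vector_space_M t])
  finally show ?thesis .
qed

end

theorem proposition6p2:
  fixes H :: "('k::field, 'h::ring_1) hopf_data"
    and \<zeta> :: "'h \<Rightarrow> 'h \<Rightarrow> 'k"
    and M :: "('k, 'h, 'm::ab_group_add) bicomodule_data"
    and N :: "('k, 'h, 'n::ab_group_add) bicomodule_data"
  assumes "cotriangular_hopf_algebra H \<zeta>"
    and "bicomodule H M"
    and "bicomodule H N"
  shows "yd_long_bimodule H (with_braiding_actions H \<zeta> M) \<and>
    yd_long_bimodule H (with_braiding_actions H \<zeta> N) \<and>
    (\<forall>f. bicomodule_hom H M N f \<longrightarrow>
       yd_long_hom H (with_braiding_actions H \<zeta> M) (with_braiding_actions H \<zeta> N) f) \<and>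
    (\<forall>t \<in> tensor_space (vscale M) (vscale N).
       yd_long_braiding H (with_braiding_actions H \<zeta> N) (with_braiding_actions H \<zeta> M)
         (yd_long_braiding H (with_braiding_actions H \<zeta> M) (with_braiding_actions H \<zeta> N) t) = t)"
proof -
  interpret cotriangular_hopf_algebra H \<zeta> by fact
  interpret M: bicomodule H M by fact
  interpret N: bicomodule H N by fact
  interpret cotriangular_bicomodule_pair H \<zeta> M N ..
  show ?thesis
    using M.yd_long_bimodule_braiding_actions N.yd_long_bimodule_braiding_actions
      yd_long_hom_braiding_actions yd_long_braiding_symmetric
    by blast
qed

end
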